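(* Let $I\subset\mathbb{R}$ be a bounded open interval and let $\mu$ be a finite positive Borel measure on $I$. Let $(u_n)_n$ be a bounded sequence of $H^1_\mu(I)$. Then there exist a subsequence $(u_{n_k})_k$ and a function $u$ such that $u_{n_k}(x)\to u(x)$ for $\mu$-a.e. point $x\in I$ at which $T_\mu(x)=\mathbb{R}$.
   Context: Sobolev space and gradients with respect to $\mu$ (Zhikov's definition). A function $u\in L^2_\mu(I)$ belongs to $H^1_\mu(I)$ if there exist a sequence $(u_n)_n$ in $C^\infty(\overline{I})$ and $v\in L^2_\mu(I)$ such that $u_n\to u$ and $u_n'\to v$ in $L^2_\mu(I)$. The set of all such limits $v$ (over all such sequences) is denoted $\Gamma(u)$. $\Gamma(u)$ is a closed affine subspace of $L^2_\mu(I)$ with direction the closed linear subspace $\Gamma(0)$. The tangential gradient $\nabla_\mu u$ is the unique element of $\Gamma(u)$ with minimal $L^2_\mu$-norm, and the norm of $H^1_\mu(I)$ is given by $\|u\|_{H^1_\mu(I)}^2=\|u\|_{L^2_\mu(I)}^2+\|\nabla_\mu u\|_{L^2_\mu(I)}^2$. Tangent space. Let $\xi=p_{\Gamma(0)}(1)$ be the orthogonal projection, in the Hilbert space $L^2_\mu(I)$, of the constant function $1$ onto $\Gamma(0)$. For $\mu$-a.e. $x\in I$, $T_\mu(x)=(\operatorname{span}(\xi(x)))^\perp\subseteq\mathbb{R}$; so $T_\mu(x)$ is either $\{0\}$ or $\mathbb{R}$. *)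

theory Defs
  imports "HOL-Analysis.Analysis"
begin

text \<open>
  Throughout, the bounded open interval \<open>I\<close> is the underlying space of the measure,
  \<open>I = space M\<close>, and elements of \<open>L\<^sup>2(M)\<close> are given by representatives, so
  equalities between them are meant almost everywhere.
\<close>

definition L2 :: "real measure \<Rightarrow> (real \<Rightarrow> real) set"
  where "L2 M = {f \<in> borel_measurable M. integrable M (\<lambda>x. (f x)\<^sup>2)}"

definition L2_inner :: "real measure \<Rightarrow> (real \<Rightarrow> real) \<Rightarrow> (real \<Rightarrow> real) \<Rightarrow> real"
  where "L2_inner M f g = (\<integral>x. f x * g x \<partial>M)"

definition L2_norm :: "real measure \<Rightarrow> (real \<Rightarrow> real) \<Rightarrow> real"
  where "L2_norm M f = sqrt (L2_inner M f f)"

definition L2_tendsto :: "real measure \<Rightarrow> (nat \<Rightarrow> real \<Rightarrow> real) \<Rightarrow> (real \<Rightarrow> real) \<Rightarrow> bool"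
  where "L2_tendsto M f g \<longleftrightarrow>
    (\<forall>n. f n \<in> L2 M) \<and> g \<in> L2 M \<and> (\<lambda>n. L2_norm M (\<lambda>x. f n x - g x)) \<longlonglongrightarrow> 0"

text \<open>
  \<open>C\<^sup>\<infinity>(S)\<close> for a compact interval \<open>S\<close>: \<open>D k\<close> is the \<open>k\<close>-th derivative, one-sided at the
  endpoints. The values of the function outside \<open>S\<close> are irrelevant.
\<close>

definition smooth_functions :: "real set \<Rightarrow> (real \<Rightarrow> real) set"
  where "smooth_functions S = {f. \<exists>D :: nat \<Rightarrow> real \<Rightarrow> real. D 0 = f \<and>
    (\<forall>k. \<forall>x\<in>S. (D k has_real_derivative D (Suc k) x) (at x within S))}"

text \<open>
  The set \<open>\<Gamma>(u)\<close> of all gradients of \<open>u\<close>. As \<open>space M\<close> is open, \<open>deriv\<close> is the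
  classical derivative at every point of \<open>space M\<close>.
\<close>

definition gradients :: "real measure \<Rightarrow> (real \<Rightarrow> real) \<Rightarrow> (real \<Rightarrow> real) set"
  where "gradients M u = {v \<in> L2 M. \<exists>\<phi> :: nat \<Rightarrow> real \<Rightarrow> real.
    (\<forall>n. \<phi> n \<in> smooth_functions (closure (space M))) \<and>
    L2_tendsto M \<phi> u \<and> L2_tendsto M (\<lambda>n. deriv (\<phi> n)) v}"

definition H1 :: "real measure \<Rightarrow> (real \<Rightarrow> real) set"
  where "H1 M = {u \<in> L2 M. gradients M u \<noteq> {}}"

text \<open>
  The minimiser is unique almost everywhere, since \<open>\<Gamma>(u)\<close> is a closed affine subspace;
  \<open>arg_min\<close> picks a representative.
\<close>

definition tangential_gradient :: "real measure \<Rightarrow> (real \<Rightarrow> real) \<Rightarrow> real \<Rightarrow> real"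
  where "tangential_gradient M u = arg_min (L2_norm M) (\<lambda>v. v \<in> gradients M u)"

definition H1_norm :: "real measure \<Rightarrow> (real \<Rightarrow> real) \<Rightarrow> real"
  where "H1_norm M u = sqrt ((L2_norm M u)\<^sup>2 + (L2_norm M (tangential_gradient M u))\<^sup>2)"

text \<open>
  A representative of the orthogonal projection of \<open>f\<close> onto the closed linear subspace \<open>V\<close>
  of \<open>L\<^sup>2(M)\<close>; it is unique almost everywhere.
\<close>

definition L2_projection :: "real measure \<Rightarrow> (real \<Rightarrow> real) set \<Rightarrow> (real \<Rightarrow> real) \<Rightarrow> real \<Rightarrow> real"
  where "L2_projection M V f =
    (SOME g. g \<in> V \<and> (\<forall>h\<in>V. L2_inner M (\<lambda>x. f x - g x) h = 0))"

definition tangent_space :: "real measure \<Rightarrow> real \<Rightarrow> real set"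
  where "tangent_space M x =
    orthogonal_comp (span {L2_projection M (gradients M (\<lambda>x. 0)) (\<lambda>x. 1) x})"

end

theory Submission
  imports Defs "HOL-Complex_Analysis.Great_Picard"
begin

text \<open>
  The derivative, defined on the smooth functions, is an unbounded operator on \<open>L\<^sup>2(M)\<close> which need
  not be closable: \<open>\<Gamma>(0)\<close> is the multivalued part of its closure. As for every such operator, the
  orthogonal complement of \<open>\<Gamma>(0)\<close> is the closure of the domain of the adjoint, that is, of the
  fields \<open>w\<close> for which some \<open>h\<close> in \<open>L\<^sup>2(M)\<close> satisfies \<open>\<integral> \<phi>' w dM = \<integral> \<phi> h dM\<close> for all smooth
  \<open>\<phi>\<close> (\<open>weak_adjoint\<close>). In particular \<open>1 - \<xi>\<close> is a limit of such fields \<open>w\<^sub>n\<close>; they come from the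
  minimisers of \<open>t \<parallel>u\<parallel>\<^sup>2 + \<parallel>v - 1\<parallel>\<^sup>2\<close> over the closed graph as \<open>t\<close> tends to infinity
  (\<open>projection_approximation\<close>). At almost every point with tangent space \<open>\<real>\<close> one has \<open>\<xi> = 0\<close>, so
  some \<open>w\<^sub>n\<close> does not vanish there.

  On an interval the adjoint is explicit. The test functions do not have to vanish at the end points,
  so an integration by parts (Fubini) turns the identity for \<open>w\<close> into \<open>w M = W dx\<close> with
  \<open>W(x) = \<integral>\<^bsub>y > x\<^esub> h dM\<close> (\<open>weak_adjoint_density\<close>). Hence \<open>W \<noteq> 0\<close> almost everywhere on
  \<open>{w \<noteq> 0}\<close>, and \<open>W\<close> is continuous from the right. If \<open>W(x) > 0\<close>, then \<open>W \<ge> c > 0\<close> on some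
  interval \<open>(x, x + d)\<close>, and for \<open>y\<close> in it
    \<open>c \<bar>\<phi>(y) - \<phi>(x)\<bar> \<le> \<integral>\<^bsub>(x,y)\<^esub> \<bar>\<phi>'\<bar> W dt = \<integral>\<^bsub>(x,y)\<^esub> \<bar>\<phi>'\<bar> w dM\<close>,
  which by Young's inequality tends to \<open>0\<close> as \<open>y\<close> decreases to \<open>x\<close>, uniformly over all smooth \<open>\<phi>\<close> with
  \<open>\<parallel>\<phi>'\<parallel>\<close> bounded (\<open>regular_point_equicontinuous\<close>).

  A bounded sequence in \<open>H\<^sup>1\<close> is replaced by smooth functions with bounded norms, at a distance tending
  to \<open>0\<close> in \<open>L\<^sup>2(M)\<close>. A diagonal subsequence of these converges at every rational point where the
  sequence is bounded; such points accumulate from the right at every \<open>x\<close> with \<open>W(x) \<noteq> 0\<close>, and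
  equicontinuity from the right carries the convergence over to \<open>x\<close>.
\<close>

section \<open>Calculus in L2\<close>

text \<open>
  Estimates for products are used in this form, with a free parameter \<open>e\<close>, in place of the
  Cauchy-Schwarz inequality: integrating it costs nothing, and a suitable \<open>e\<close> makes the bound small
  when one of the two factors is.
\<close>

lemma young_inequality:
  fixes c d e :: real
  assumes "0 < e"
  shows "\<bar>c * d\<bar> \<le> e * c\<^sup>2 + d\<^sup>2 / e"
proof -
  have "0 \<le> (e * \<bar>c\<bar> - \<bar>d\<bar>)\<^sup>2" by simp
  then have "2 * e * \<bar>c * d\<bar> \<le> e\<^sup>2 * c\<^sup>2 + d\<^sup>2"
    by (simp add: power2_eq_square algebra_simps abs_mult)
  moreover have "0 \<le> e * \<bar>c * d\<bar>" using assms by simp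
  ultimately have "e * \<bar>c * d\<bar> \<le> e\<^sup>2 * c\<^sup>2 + d\<^sup>2" by linarith
  then show ?thesis using assms by (simp add: field_simps power2_eq_square)
qed

lemma L2_mult_integrable:
  assumes "f \<in> L2 M" "g \<in> L2 M"
  shows "integrable M (\<lambda>x. f x * g x)"
proof (rule Bochner_Integration.integrable_bound[where f = "\<lambda>x. (f x)\<^sup>2 + (g x)\<^sup>2"])
  show "integrable M (\<lambda>x. (f x)\<^sup>2 + (g x)\<^sup>2)"
    using assms by (auto simp: L2_def)
  show "(\<lambda>x. f x * g x) \<in> borel_measurable M"
    using assms by (auto simp: L2_def)
  have "\<bar>c * d\<bar> \<le> c\<^sup>2 + d\<^sup>2" for c d :: real
    using young_inequality[of 1 c d] by simp
  then show "AE x in M. norm (f x * g x) \<le> norm ((f x)\<^sup>2 + (g x)\<^sup>2)"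
    by (intro AE_I2) (auto intro: order_trans[OF _ abs_ge_self])
qed

lemma L2_sq_integrable: "f \<in> L2 M \<Longrightarrow> integrable M (\<lambda>x. (f x)\<^sup>2)"
  by (simp add: L2_def)

lemma L2_measurable: "f \<in> L2 M \<Longrightarrow> f \<in> borel_measurable M"
  by (simp add: L2_def)

lemma L2_lincomb:
  assumes "f \<in> L2 M" "g \<in> L2 M"
  shows "(\<lambda>x. c * f x + d * g x) \<in> L2 M"
proof -
  have "(c * f x + d * g x)\<^sup>2 = c\<^sup>2 * (f x)\<^sup>2 + d\<^sup>2 * (g x)\<^sup>2 + 2 * c * d * (f x * g x)" for x
    by (simp add: power2_eq_square algebra_simps)
  then have "integrable M (\<lambda>x. (c * f x + d * g x)\<^sup>2)"
    using L2_mult_integrable[OF assms] L2_sq_integrable[OF assms(1)] L2_sq_integrable[OF assms(2)]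
    by simp
  then show ?thesis
    using assms by (auto simp: L2_def)
qed

lemma L2_diff: "f \<in> L2 M \<Longrightarrow> g \<in> L2 M \<Longrightarrow> (\<lambda>x. f x - g x) \<in> L2 M"
  using L2_lincomb[of f M g 1 "-1"] by simp

lemma L2_add: "f \<in> L2 M \<Longrightarrow> g \<in> L2 M \<Longrightarrow> (\<lambda>x. f x + g x) \<in> L2 M"
  using L2_lincomb[of f M g 1 1] by simp

lemma L2_cmult: "f \<in> L2 M \<Longrightarrow> (\<lambda>x. c * f x) \<in> L2 M"
  using L2_lincomb[of f M f c 0] by simp

lemma L2_bounded:
  assumes "finite_measure M" "f \<in> borel_measurable M" "\<And>x. x \<in> space M \<Longrightarrow> \<bar>f x\<bar> \<le> B"
  shows "f \<in> L2 M"
proof -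
  interpret finite_measure M by fact
  have "integrable M (\<lambda>x. (f x)\<^sup>2)"
  proof (rule integrable_const_bound[where B = "B\<^sup>2"])
    show "AE x in M. norm ((f x)\<^sup>2) \<le> B\<^sup>2"
      using assms(3) by (auto intro!: AE_I2 abs_le_square_iff[THEN iffD1] order_trans[OF _ abs_ge_self])
  qed (use assms in auto)
  then show ?thesis
    using assms by (simp add: L2_def)
qed

lemma L2_const: "finite_measure M \<Longrightarrow> (\<lambda>x. c) \<in> L2 M"
  by (rule L2_bounded[where B = "\<bar>c\<bar>"]) auto

lemma L2_integrable: "finite_measure M \<Longrightarrow> f \<in> L2 M \<Longrightarrow> integrable M f"
  using L2_mult_integrable[OF L2_const[of M 1], of f] by simp

lemma L2_norm_eq: "L2_norm M f = sqrt (LINT x|M. (f x)\<^sup>2)"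
  by (simp add: L2_norm_def L2_inner_def power2_eq_square)

lemma L2_young:
  assumes "f \<in> L2 M" "g \<in> L2 M" "0 < e"
  shows "(LINT x|M. \<bar>f x * g x\<bar>) \<le> e * (LINT x|M. (f x)\<^sup>2) + (LINT x|M. (g x)\<^sup>2) / e"
proof -
  have "(LINT x|M. \<bar>f x * g x\<bar>) \<le> (LINT x|M. e * (f x)\<^sup>2 + (g x)\<^sup>2 / e)"
    using assms L2_mult_integrable young_inequality[OF assms(3)] L2_sq_integrable
    by (intro integral_mono) auto
  also have "\<dots> = e * (LINT x|M. (f x)\<^sup>2) + (LINT x|M. (g x)\<^sup>2) / e"
    using assms L2_sq_integrable by simp
  finally show ?thesis .
qed

lemma L2_sq_triangle:
  assumes "f \<in> L2 M" "g \<in> L2 M"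
  shows "(LINT x|M. (f x + g x)\<^sup>2) \<le> 2 * (LINT x|M. (f x)\<^sup>2) + 2 * (LINT x|M. (g x)\<^sup>2)"
proof -
  have "(LINT x|M. (f x + g x)\<^sup>2) \<le> (LINT x|M. 2 * (f x)\<^sup>2 + 2 * (g x)\<^sup>2)"
  proof (intro integral_mono)
    show "integrable M (\<lambda>x. (f x + g x)\<^sup>2)"
      using L2_add[OF assms] by (rule L2_sq_integrable)
    fix x
    have "0 \<le> (f x - g x)\<^sup>2" by simp
    then show "(f x + g x)\<^sup>2 \<le> 2 * (f x)\<^sup>2 + 2 * (g x)\<^sup>2"
      by (simp add: power2_eq_square algebra_simps)
  qed (use assms L2_sq_integrable in auto)
  then show ?thesis
    using assms L2_sq_integrable by simp
qed

lemma L2_sq_triangle3: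
  assumes "f \<in> L2 M" "g \<in> L2 M" "h \<in> L2 M"
  shows "(LINT x|M. (f x - h x)\<^sup>2) \<le> 2 * (LINT x|M. (f x - g x)\<^sup>2) + 2 * (LINT x|M. (g x - h x)\<^sup>2)"
  using L2_sq_triangle[OF L2_diff[OF assms(1,2)] L2_diff[OF assms(2,3)]] by simp

text \<open>
  Strong convergence implies weak convergence.
\<close>

lemma L2_inner_tendsto:
  assumes f: "\<And>n. f n \<in> L2 M" "f' \<in> L2 M" and g: "g \<in> L2 M"
    and lim: "(\<lambda>n. LINT x|M. (f n x - f' x)\<^sup>2) \<longlonglongrightarrow> 0"
  shows "(\<lambda>n. LINT x|M. f n x * g x) \<longlonglongrightarrow> (LINT x|M. f' x * g x)"
proof (rule LIMSEQ_I)
  fix r :: real assume r: "0 < r"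
  define G where "G = (LINT x|M. (g x)\<^sup>2)"
  have G: "0 \<le> G" by (simp add: G_def)
  \<comment> \<open>The error is at most \<open>e G\<close> plus the squared distance divided by \<open>e\<close>; each term gets half of \<open>r\<close>.\<close>
  define e where "e = r / (2 * (G + 1))"
  have e: "0 < e" "e * G < r / 2 + 0"
  proof -
    show "0 < e" using r G by (simp add: e_def)
    have "e * G < e * (G + 1)" using \<open>0 < e\<close> by simp
    also have "\<dots> = r / 2" using G by (simp add: e_def field_simps)
    finally show "e * G < r / 2 + 0" by simp
  qed
  have "\<forall>\<^sub>F n in sequentially. (LINT x|M. (f n x - f' x)\<^sup>2) < e * (r / 2)"
    using lim e r by (intro order_tendstoD(2)) auto
  then obtain N where N: "\<And>n. n \<ge> N \<Longrightarrow> (LINT x|M. (f n x - f' x)\<^sup>2) < e * (r / 2)"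
    by (auto simp: eventually_sequentially)
  show "\<exists>no. \<forall>n\<ge>no. norm ((LINT x|M. f n x * g x) - (LINT x|M. f' x * g x)) < r"
  proof (intro exI allI impI)
    fix n assume n: "n \<ge> N"
    have "(LINT x|M. f n x * g x) - (LINT x|M. f' x * g x) = (LINT x|M. g x * (f n x - f' x))"
      using L2_mult_integrable[OF f(1)[of n] g] L2_mult_integrable[OF f(2) g]
      by (simp add: algebra_simps)
    also have "\<bar>\<dots>\<bar> \<le> (LINT x|M. \<bar>g x * (f n x - f' x)\<bar>)"
      by (rule integral_abs_bound)
    also have "\<dots> \<le> e * G + (LINT x|M. (f n x - f' x)\<^sup>2) / e"
      unfolding G_def by (intro L2_young g L2_diff f e)
    also have "\<dots> < r / 2 + (e * (r / 2)) / e"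
      using e N[OF n] divide_strict_right_mono[OF N[OF n] e(1)] by linarith
    also have "\<dots> = r" using e by simp
    finally show "norm ((LINT x|M. f n x * g x) - (LINT x|M. f' x * g x)) < r" by simp
  qed
qed

lemma L2_sq_tendsto:
  assumes f: "\<And>n. f n \<in> L2 M" "f' \<in> L2 M"
    and lim: "(\<lambda>n. LINT x|M. (f n x - f' x)\<^sup>2) \<longlonglongrightarrow> 0"
  shows "(\<lambda>n. LINT x|M. (f n x)\<^sup>2) \<longlonglongrightarrow> (LINT x|M. (f' x)\<^sup>2)"
proof -
  have "(LINT x|M. (f n x)\<^sup>2) =
      (LINT x|M. (f n x - f' x)\<^sup>2) + 2 * (LINT x|M. f n x * f' x) - (LINT x|M. (f' x)\<^sup>2)" for n
  proof -
    have "(LINT x|M. (f n x)\<^sup>2) = (LINT x|M. ((f n x - f' x)\<^sup>2 + 2 * (f n x * f' x)) - (f' x)\<^sup>2)"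
      by (intro Bochner_Integration.integral_cong) (auto simp: power2_eq_square algebra_simps)
    also have "\<dots> = (LINT x|M. (f n x - f' x)\<^sup>2) + 2 * (LINT x|M. f n x * f' x) - (LINT x|M. (f' x)\<^sup>2)"
      using L2_mult_integrable[OF f(1)[of n] f(2)] L2_sq_integrable[OF f(2)]
        L2_sq_integrable[OF L2_diff[OF f(1)[of n] f(2)]]
      by (subst Bochner_Integration.integral_diff) auto
    finally show ?thesis .
  qed
  moreover have "(\<lambda>n. (LINT x|M. (f n x - f' x)\<^sup>2) + 2 * (LINT x|M. f n x * f' x) - (LINT x|M. (f' x)\<^sup>2))
      \<longlonglongrightarrow> 0 + 2 * (LINT x|M. f' x * f' x) - (LINT x|M. (f' x)\<^sup>2)"
    by (intro tendsto_intros lim L2_inner_tendsto f)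
  ultimately show ?thesis
    by (simp add: power2_eq_square)
qed

text \<open>
  The Riesz-Fischer theorem. On a finite measure space a Cauchy sequence in \<open>L\<^sup>2\<close> is Cauchy in
  \<open>L\<^sup>1\<close>, hence has an almost everywhere convergent subsequence; Fatou's lemma shows that its limit is
  also the limit in \<open>L\<^sup>2\<close>.
\<close>

lemma L2_complete:
  assumes fin: "finite_measure M" and f: "\<And>n. f n \<in> L2 M"
    and cauchy: "\<And>e. 0 < e \<Longrightarrow> \<exists>N. \<forall>i\<ge>N. \<forall>j\<ge>N. (LINT x|M. (f i x - f j x)\<^sup>2) < e"
  shows "\<exists>g\<in>L2 M. (\<lambda>n. LINT x|M. (f n x - g x)\<^sup>2) \<longlonglongrightarrow> 0"
proof -
  interpret finite_measure M by fact
  have [measurable]: "f n \<in> borel_measurable M" for n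
    using f by (rule L2_measurable)
  have L1: "\<exists>N. \<forall>i\<ge>N. \<forall>j\<ge>N. (LINT x|M. norm (f i x - f j x)) < e" if e: "0 < e" for e
  proof -
    define m where "m = measure M (space M)"
    have m: "0 \<le> m" by (simp add: m_def)
    \<comment> \<open>The parameter in Young's inequality against the constant \<open>1\<close>, whose squared norm is \<open>m\<close>.\<close>
    define d where "d = e / (2 * (m + 1))"
    have d: "0 < d" using e m by (simp add: d_def)
    have dm: "d * m < e / 2"
    proof -
      have "d * m < d * (m + 1)" using d by simp
      also have "\<dots> = e / 2" using m by (simp add: d_def field_simps)
      finally show ?thesis .
    qed
    obtain N where N: "\<And>i j. i \<ge> N \<Longrightarrow> j \<ge> N \<Longrightarrow> (LINT x|M. (f i x - f j x)\<^sup>2) < d * (e / 2)"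
      using cauchy[of "d * (e / 2)"] d e by auto
    have "(LINT x|M. norm (f i x - f j x)) < e" if "i \<ge> N" "j \<ge> N" for i j
    proof -
      have "(LINT x|M. \<bar>1 * (f i x - f j x)\<bar>) \<le> d * (LINT x|M. 1\<^sup>2) + (LINT x|M. (f i x - f j x)\<^sup>2) / d"
        by (intro L2_young L2_const fin L2_diff f d)
      also have "\<dots> < e / 2 + d * (e / 2) / d"
        using dm divide_strict_right_mono[OF N[OF that] d] by (simp add: m_def)
      also have "\<dots> = e" using d by simp
      finally show ?thesis by simp
    qed
    then show ?thesis by blast
  qed
  obtain r where r: "strict_mono r" "AE x in M. Cauchy (\<lambda>i. f (r i) x)"
    using cauchy_L1_AE_cauchy_subseq[of M f] L2_integrable[OF fin f] L1 by blast
  define g where "g x = lim (\<lambda>i. f (r i) x)" for x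
  have [measurable]: "g \<in> borel_measurable M"
    unfolding g_def by measurable
  have glim: "AE x in M. (\<lambda>i. f (r i) x) \<longlonglongrightarrow> g x"
    using r(2) by eventually_elim (auto simp: g_def convergent_LIMSEQ_iff Cauchy_convergent_iff)
  have fatou: "(\<integral>\<^sup>+x. ennreal ((f n x - g x)\<^sup>2) \<partial>M) \<le> ennreal e"
    if e: "0 < e" and N: "\<forall>i\<ge>N. \<forall>j\<ge>N. (LINT x|M. (f i x - f j x)\<^sup>2) < e" and n: "n \<ge> N" for e N n
  proof -
    have "AE x in M. (\<lambda>i. ennreal ((f n x - f (r i) x)\<^sup>2)) \<longlonglongrightarrow> ennreal ((f n x - g x)\<^sup>2)"
      using glim by eventually_elim (intro tendsto_ennrealI tendsto_power tendsto_diff tendsto_const)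
    then have "AE x in M. ennreal ((f n x - g x)\<^sup>2) = liminf (\<lambda>i. ennreal ((f n x - f (r i) x)\<^sup>2))"
      by eventually_elim (rule lim_imp_Liminf[symmetric, OF sequentially_bot])
    then have "(\<integral>\<^sup>+x. ennreal ((f n x - g x)\<^sup>2) \<partial>M)
        = (\<integral>\<^sup>+x. liminf (\<lambda>i. ennreal ((f n x - f (r i) x)\<^sup>2)) \<partial>M)"
      by (rule nn_integral_cong_AE)
    also have "\<dots> \<le> liminf (\<lambda>i. \<integral>\<^sup>+x. ennreal ((f n x - f (r i) x)\<^sup>2) \<partial>M)"
      by (intro nn_integral_liminf) measurable
    also have "\<dots> \<le> limsup (\<lambda>i. \<integral>\<^sup>+x. ennreal ((f n x - f (r i) x)\<^sup>2) \<partial>M)"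
      by (intro Liminf_le_Limsup) auto
    also have "\<dots> \<le> ennreal e"
    proof (rule Limsup_bounded)
      show "\<forall>\<^sub>F i in sequentially. (\<integral>\<^sup>+x. ennreal ((f n x - f (r i) x)\<^sup>2) \<partial>M) \<le> ennreal e"
        using eventually_ge_at_top[of N]
      proof eventually_elim
        case (elim i)
        have "r i \<ge> N" using elim strict_mono_imp_increasing[OF r(1), of i] by simp
        then have "(LINT x|M. (f n x - f (r i) x)\<^sup>2) < e" using N n by blast
        then show ?case
          using L2_sq_integrable[OF L2_diff[OF f[of n] f[of "r i"]]]
          by (simp add: nn_integral_eq_integral ennreal_leI)
      qed
    qed
    finally show ?thesis .
  qed
  have diff: "(\<lambda>x. f n x - g x) \<in> L2 M \<and> (LINT x|M. (f n x - g x)\<^sup>2) \<le> e"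
    if e: "0 < e" and N: "\<forall>i\<ge>N. \<forall>j\<ge>N. (LINT x|M. (f i x - f j x)\<^sup>2) < e" and n: "n \<ge> N" for e N n
  proof -
    have int: "integrable M (\<lambda>x. (f n x - g x)\<^sup>2)"
      using fatou[OF that] by (auto simp: integrable_iff_bounded le_less_trans)
    moreover have "(LINT x|M. (f n x - g x)\<^sup>2) \<le> e"
      using fatou[OF that] e by (simp add: nn_integral_eq_integral[OF int])
    ultimately show ?thesis
      by (simp add: L2_def)
  qed
  obtain N1 where "\<forall>i\<ge>N1. \<forall>j\<ge>N1. (LINT x|M. (f i x - f j x)\<^sup>2) < 1"
    using cauchy[of 1] by auto
  then have "(\<lambda>x. f N1 x - g x) \<in> L2 M"
    using diff[of 1 N1 N1] by simp
  then have "g \<in> L2 M"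
    using L2_diff[OF f[of N1]] by fastforce
  moreover have "(\<lambda>n. LINT x|M. (f n x - g x)\<^sup>2) \<longlonglongrightarrow> 0"
  proof (rule LIMSEQ_I)
    fix e :: real assume e: "0 < e"
    obtain N where "\<forall>i\<ge>N. \<forall>j\<ge>N. (LINT x|M. (f i x - f j x)\<^sup>2) < e / 2"
      using cauchy[of "e / 2"] e by auto
    then have "(LINT x|M. (f n x - g x)\<^sup>2) \<le> e / 2" if "n \<ge> N" for n
      using diff[of "e / 2" N n] e that by simp
    then show "\<exists>N. \<forall>n\<ge>N. norm ((LINT x|M. (f n x - g x)\<^sup>2) - 0) < e"
      using e by (intro exI[of _ N]) (fastforce intro: le_less_trans)
  qed
  ultimately show ?thesis by blast
qed

lemma L2_parallelogram:
  assumes "f \<in> L2 M" "g \<in> L2 M"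
  shows "(LINT x|M. (f x - g x)\<^sup>2) =
    2 * (LINT x|M. (f x)\<^sup>2) + 2 * (LINT x|M. (g x)\<^sup>2) - 4 * (LINT x|M. (1/2 * f x + 1/2 * g x)\<^sup>2)"
proof -
  have "(LINT x|M. (f x - g x)\<^sup>2) =
      (LINT x|M. 2 * (f x)\<^sup>2 + 2 * (g x)\<^sup>2 - 4 * (1/2 * f x + 1/2 * g x)\<^sup>2)"
    by (intro Bochner_Integration.integral_cong) (auto simp: power2_eq_square algebra_simps)
  also have "\<dots> = 2 * (LINT x|M. (f x)\<^sup>2) + 2 * (LINT x|M. (g x)\<^sup>2)
      - 4 * (LINT x|M. (1/2 * f x + 1/2 * g x)\<^sup>2)"
    using L2_sq_integrable[OF assms(1)] L2_sq_integrable[OF assms(2)]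
      L2_sq_integrable[OF L2_lincomb[OF assms, of "1/2" "1/2"]]
    by (subst Bochner_Integration.integral_diff) auto
  finally show ?thesis .
qed

lemma L2_tendsto_iff:
  "L2_tendsto M f g \<longleftrightarrow>
    (\<forall>n. f n \<in> L2 M) \<and> g \<in> L2 M \<and> (\<lambda>n. LINT x|M. (f n x - g x)\<^sup>2) \<longlonglongrightarrow> 0"
proof -
  have "(\<lambda>n. sqrt (s n)) \<longlonglongrightarrow> 0 \<longleftrightarrow> s \<longlonglongrightarrow> 0" if "\<And>n. 0 \<le> s n" for s :: "nat \<Rightarrow> real"
  proof
    assume "(\<lambda>n. sqrt (s n)) \<longlonglongrightarrow> 0"
    from tendsto_power[OF this, of 2] show "s \<longlonglongrightarrow> 0"
      using that by simp
  next
    assume "s \<longlonglongrightarrow> 0"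
    from tendsto_real_sqrt[OF this] show "(\<lambda>n. sqrt (s n)) \<longlonglongrightarrow> 0" by simp
  qed
  from this[of "\<lambda>n. LINT x|M. (f n x - g x)\<^sup>2"] show ?thesis
    by (simp add: L2_tendsto_def L2_norm_eq)
qed

section \<open>Signed densities determined by their moments\<close>

text \<open>
  Here \<open>f\<close> is a Borel function on the line, while \<open>M\<close> may live on a subspace of it; the hypothesis on
  the identity is what relates the two \<open>\<sigma>\<close>-algebras.
\<close>

lemma bounded_mult_integrable:
  fixes f g :: "real \<Rightarrow> real"
  assumes id: "(\<lambda>x. x) \<in> M \<rightarrow>\<^sub>M borel" and f: "f \<in> borel_measurable borel"
    and B: "\<And>x. x \<in> space M \<Longrightarrow> \<bar>f x\<bar> \<le> B" and g: "integrable M g"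
  shows "integrable M (\<lambda>x. f x * g x)"
proof (rule Bochner_Integration.integrable_bound)
  show "integrable M (\<lambda>x. B * \<bar>g x\<bar>)" using g by simp
  have "f \<in> borel_measurable M" by (rule measurable_compose[OF id f])
  then show "(\<lambda>x. f x * g x) \<in> borel_measurable M"
    using g by (intro borel_measurable_times) auto
  show "AE x in M. norm (f x * g x) \<le> norm (B * \<bar>g x\<bar>)"
  proof (intro AE_I2)
    fix x assume "x \<in> space M"
    from B[OF this] have "\<bar>f x\<bar> * \<bar>g x\<bar> \<le> \<bar>B\<bar> * \<bar>g x\<bar>"
      by (intro mult_right_mono) auto
    then show "norm (f x * g x) \<le> norm (B * \<bar>g x\<bar>)" by (simp add: abs_mult)
  qed
qed

context
  fixes M1 M2 :: "real measure" and g1 g2 :: "real \<Rightarrow> real" and a b :: real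
  assumes id1: "(\<lambda>x. x) \<in> M1 \<rightarrow>\<^sub>M borel" and id2: "(\<lambda>x. x) \<in> M2 \<rightarrow>\<^sub>M borel"
    and sp1: "space M1 \<subseteq> {a..b}" and sp2: "space M2 \<subseteq> {a..b}"
    and g1: "integrable M1 g1" and g2: "integrable M2 g2"
    and moments: "\<And>p. (LINT x|M1. poly p x * g1 x) = (LINT x|M2. poly p x * g2 x)"
begin

text \<open>
  Polynomials are uniformly dense in the continuous functions on \<open>{a..b}\<close>, and \<open>g1\<close>, \<open>g2\<close> are
  integrable.
\<close>

lemma moments_continuous:
  assumes f: "continuous_on UNIV f" and B: "\<And>x. \<bar>f x\<bar> \<le> B"
  shows "(LINT x|M1. f x * g1 x) = (LINT x|M2. f x * g2 x)"
proof -
  define C where "C = (LINT x|M1. \<bar>g1 x\<bar>) + (LINT x|M2. \<bar>g2 x\<bar>)"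
  have fm: "f \<in> borel_measurable borel" using f by (rule borel_measurable_continuous_onI)
  have "\<bar>(LINT x|M1. f x * g1 x) - (LINT x|M2. f x * g2 x)\<bar> \<le> e * C" if e: "0 < e" for e
  proof -
    obtain q where q: "real_polynomial_function q" "\<And>x. x \<in> {a..b} \<Longrightarrow> \<bar>f x - q x\<bar> < e"
      using Stone_Weierstrass_real_polynomial_function[of "{a..b}" f e] f e continuous_on_subset
      by (metis compact_Icc subset_UNIV)
    obtain c n where cn: "q = (\<lambda>x. \<Sum>i\<le>n. c i * x ^ i)"
      using q(1) real_polynomial_function_iff_sum by blast
    define p where "p = (\<Sum>i\<le>n. monom (c i) i)"
    have pq: "poly p x = q x" for x
      by (simp add: p_def cn poly_sum poly_monom)
    have pm: "poly p \<in> borel_measurable borel"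
      by (intro borel_measurable_continuous_onI continuous_on_poly continuous_on_id)
    have close: "\<bar>(LINT x|M. f x * g x) - (LINT x|M. poly p x * g x)\<bar> \<le> e * (LINT x|M. \<bar>g x\<bar>)"
      if id: "(\<lambda>x. x) \<in> M \<rightarrow>\<^sub>M borel" and sp: "space M \<subseteq> {a..b}" and g: "integrable M g" for M g
    proof -
      have pb: "\<bar>poly p x\<bar> \<le> B + e" if "x \<in> space M" for x
        using q(2)[of x] B[of x] sp that unfolding pq by fastforce
      have i: "integrable M (\<lambda>x. f x * g x)" "integrable M (\<lambda>x. poly p x * g x)"
        using bounded_mult_integrable[OF id fm _ g] bounded_mult_integrable[OF id pm _ g] pb B by blast+
      have "(LINT x|M. f x * g x) - (LINT x|M. poly p x * g x) = (LINT x|M. f x * g x - poly p x * g x)"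
        using i by simp
      also have "\<bar>\<dots>\<bar> \<le> (LINT x|M. \<bar>f x * g x - poly p x * g x\<bar>)"
        by (rule integral_abs_bound)
      also have "\<dots> \<le> (LINT x|M. e * \<bar>g x\<bar>)"
      proof (intro integral_mono integrable_abs Bochner_Integration.integrable_diff i)
        show "integrable M (\<lambda>x. e * \<bar>g x\<bar>)" using g by simp
        fix x assume "x \<in> space M"
        then have "\<bar>f x - q x\<bar> * \<bar>g x\<bar> \<le> e * \<bar>g x\<bar>"
          using q(2)[of x] sp by (intro mult_right_mono) auto
        then show "\<bar>f x * g x - poly p x * g x\<bar> \<le> e * \<bar>g x\<bar>"
          unfolding pq by (simp add: abs_mult left_diff_distrib[symmetric])
      qed
      finally show ?thesis by simp
    qed
    show ?thesis
      using close[OF id1 sp1 g1] close[OF id2 sp2 g2] moments[of p]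
      by (simp add: C_def distrib_left)
  qed
  note le = this
  have C: "0 \<le> C" by (simp add: C_def)
  show ?thesis
  proof (rule ccontr)
    assume ne: "\<not> ?thesis"
    define d where "d = \<bar>(LINT x|M1. f x * g1 x) - (LINT x|M2. f x * g2 x)\<bar>"
    have d: "0 < d" using ne by (simp add: d_def)
    have "d \<le> d / (2 * (C + 1)) * C"
      unfolding d_def by (rule le) (use d C in \<open>simp add: d_def\<close>)
    also have "\<dots> < d" using d C by (simp add: field_simps add_nonneg_pos)
    finally show False by simp
  qed
qed

text \<open>
  The indicator of a half-line is a bounded pointwise limit of continuous ramps.
\<close>

lemma moments_atMost:
  "(LINT x|M1. indicat_real {..c} x * g1 x) = (LINT x|M2. indicat_real {..c} x * g2 x)"
proof -
  \<comment> \<open>For \<open>n > 0\<close> equal to \<open>1\<close> up to \<open>c\<close>, then linear down to \<open>0\<close> at \<open>c + 1 / n\<close>.\<close>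
  define f where "f n x = max 0 (min 1 (1 - real n * (x - c)))" for n x
  have fc: "continuous_on UNIV (f n)" for n
    unfolding f_def by (intro continuous_intros)
  have fb: "\<bar>f n x\<bar> \<le> 1" for n x unfolding f_def by simp
  have flim: "(\<lambda>n. f n x) \<longlonglongrightarrow> indicator {..c} x" for x
  proof (cases "x \<le> c")
    case True
    then have "f n x = 1" for n
      unfolding f_def by (simp add: mult_nonneg_nonpos)
    then show ?thesis using True by simp
  next
    case False
    obtain N where N: "1 / (x - c) < real N" using reals_Archimedean2 by blast
    have "f n x = 0" if "n \<ge> N" for n
    proof -
      have "1 < real N * (x - c)" using N False by (simp add: field_simps)
      also have "\<dots> \<le> real n * (x - c)" using that False by (intro mult_right_mono) auto
      finally show ?thesis unfolding f_def by simp
    qed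
    then have "\<forall>\<^sub>F n in sequentially. f n x = 0"
      unfolding eventually_sequentially by blast
    then show ?thesis using False by (simp add: tendsto_eventually)
  qed
  have lim: "(\<lambda>n. LINT x|M. f n x * g x) \<longlonglongrightarrow> (LINT x|M. indicator {..c} x * g x)"
    if id: "(\<lambda>x. x) \<in> M \<rightarrow>\<^sub>M borel" and g: "integrable M g" for M and g :: "real \<Rightarrow> real"
  proof (rule integral_dominated_convergence[where w = "\<lambda>x. \<bar>g x\<bar>"])
    show "(\<lambda>x. indicat_real {..c} x * g x) \<in> borel_measurable M"
      using bounded_mult_integrable[OF id _ _ g, of "indicator {..c}" 1] by auto
    show "(\<lambda>x. f n x * g x) \<in> borel_measurable M" for n
      using bounded_mult_integrable[OF id borel_measurable_continuous_onI[OF fc] fb g] by auto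
    show "AE x in M. (\<lambda>n. f n x * g x) \<longlonglongrightarrow> indicat_real {..c} x * g x"
      by (intro AE_I2 tendsto_mult flim tendsto_const)
    show "AE x in M. norm (f n x * g x) \<le> \<bar>g x\<bar>" for n
      using mult_right_mono[OF fb] by (intro AE_I2) (simp add: abs_mult)
  qed (use g in simp)
  have eq: "(LINT x|M1. f n x * g1 x) = (LINT x|M2. f n x * g2 x)" for n
    by (rule moments_continuous[OF fc fb])
  show ?thesis
    by (rule LIMSEQ_unique[OF lim[OF id1 g1]]) (unfold eq, rule lim[OF id2 g2])
qed

lemma moments_indicator:
  assumes "A \<in> sets borel"
  shows "(LINT x|M1. indicat_real A x * g1 x) = (LINT x|M2. indicat_real A x * g2 x)"
proof -
  have int: "integrable M (\<lambda>x. indicat_real A x * g x)"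
    if "A \<in> sets borel" "(\<lambda>x. x) \<in> M \<rightarrow>\<^sub>M borel" "integrable M g" for A M and g :: "real \<Rightarrow> real"
    using that bounded_mult_integrable[OF that(2) _ _ that(3), of "indicator A" 1]
    by auto
  have sig: "sets (borel :: real measure) = sigma_sets UNIV (range (\<lambda>c. {..c}))"
    by (subst borel_eq_atMost) simp
  have "Int_stable (range (\<lambda>c::real. {..c}))"
    unfolding Int_stable_def by auto
  moreover have "range (\<lambda>c::real. {..c}) \<subseteq> Pow UNIV" by simp
  moreover have "A \<in> sigma_sets UNIV (range (\<lambda>c. {..c}))" using assms sig by simp
  ultimately show ?thesis
  proof (induction rule: sigma_sets_induct_disjoint)
    case (basic A)
    then show ?case using moments_atMost by auto
  next
    case empty
    then show ?case by simp
  next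
    case (compl A)
    then have A: "A \<in> sets borel" by (simp add: sig)
    have "(LINT x|M. indicat_real (UNIV - A) x * g x) = (LINT x|M. g x) - (LINT x|M. indicat_real A x * g x)"
      if "(\<lambda>x. x) \<in> M \<rightarrow>\<^sub>M borel" "integrable M g" for M and g :: "real \<Rightarrow> real"
    proof -
      have "(LINT x|M. indicat_real (UNIV - A) x * g x) = (LINT x|M. g x - indicat_real A x * g x)"
        by (intro Bochner_Integration.integral_cong) (auto simp: indicator_def)
      then show ?thesis using int[OF A that] that by simp
    qed
    moreover have "(LINT x|M1. g1 x) = (LINT x|M2. g2 x)"
      using moments[of "[:1:]"] by simp
    ultimately show ?case using compl(2) id1 id2 g1 g2 by simp
  next
    case (union A)
    then have A: "A i \<in> sets borel" for i by (auto simp: sig)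
    have lim: "(\<lambda>n. \<Sum>i<n. LINT x|M. indicat_real (A i) x * g x) \<longlonglongrightarrow> (LINT x|M. indicat_real (\<Union>i. A i) x * g x)"
      if id: "(\<lambda>x. x) \<in> M \<rightarrow>\<^sub>M borel" and g: "integrable M g" for M and g :: "real \<Rightarrow> real"
    proof -
      have "(\<lambda>n. LINT x|M. indicat_real (\<Union>i<n. A i) x * g x) \<longlonglongrightarrow> (LINT x|M. indicat_real (\<Union>i. A i) x * g x)"
      proof (rule integral_dominated_convergence[where w = "\<lambda>x. \<bar>g x\<bar>"])
        show "(\<lambda>x. indicat_real (\<Union>i. A i) x * g x) \<in> borel_measurable M"
          using A by (intro borel_measurable_integrable int id g) auto
        show "(\<lambda>x. indicat_real (\<Union>i<n. A i) x * g x) \<in> borel_measurable M" for n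
          using A by (intro borel_measurable_integrable int id g) auto
        show "AE x in M. (\<lambda>n. indicat_real (\<Union>i<n. A i) x * g x) \<longlonglongrightarrow> indicat_real (\<Union>i. A i) x * g x"
          by (intro AE_I2 tendsto_mult LIMSEQ_indicator_UN tendsto_const)
        show "AE x in M. norm (indicat_real (\<Union>i<n. A i) x * g x) \<le> \<bar>g x\<bar>" for n
          by (intro AE_I2) (auto simp: indicator_def)
      qed (use g in simp)
      moreover have "(LINT x|M. indicat_real (\<Union>i<n. A i) x * g x) = (\<Sum>i<n. LINT x|M. indicat_real (A i) x * g x)" for n
      proof -
        have "indicat_real (\<Union>i<n. A i) x = (\<Sum>i<n. indicat_real (A i) x)" for x
          using union(1) by (intro indicator_UN_disjoint) (auto simp: disjoint_family_on_def)
        then have "(LINT x|M. indicat_real (\<Union>i<n. A i) x * g x) = (LINT x|M. (\<Sum>i<n. indicat_real (A i) x * g x))"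
          by (simp add: sum_distrib_right)
        then show ?thesis
          by (simp only: Bochner_Integration.integral_sum[OF int[OF A id g]])
      qed
      ultimately show ?thesis by simp
    qed
    show ?case
      by (rule LIMSEQ_unique[OF lim[OF id1 g1]]) (unfold union(3), rule lim[OF id2 g2])
  qed
qed

lemma moments_nonneg:
  assumes "f \<in> borel_measurable borel" "\<And>x. 0 \<le> f x" "\<And>x. f x \<le> B"
  shows "(LINT x|M1. f x * g1 x) = (LINT x|M2. f x * g2 x)"
proof -
  have int: "integrable M (\<lambda>x. u x * g x)"
    if "u \<in> borel_measurable borel" "\<And>x. 0 \<le> u x" "\<And>x. u x \<le> B"
      "(\<lambda>x. x) \<in> M \<rightarrow>\<^sub>M borel" "integrable M g" for u B M and g :: "real \<Rightarrow> real"
    using that by (intro bounded_mult_integrable[where B = B]) auto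
  have "\<forall>B. (\<forall>x. f x \<le> B) \<longrightarrow> (LINT x|M1. f x * g1 x) = (LINT x|M2. f x * g2 x)"
    using assms(1,2)
  proof (induction rule: borel_measurable_induct_real)
    case (set A)
    then show ?case using moments_indicator by simp
  next
    case (mult u c)
    show ?case
    proof (intro allI impI)
      fix B assume B: "\<forall>x. c * u x \<le> B"
      show "(LINT x|M1. c * u x * g1 x) = (LINT x|M2. c * u x * g2 x)"
      proof (cases "c = 0")
        case False
        then have "u x \<le> B / c" for x
          using B mult(1) by (simp add: field_simps)
        then have "(LINT x|M1. u x * g1 x) = (LINT x|M2. u x * g2 x)"
          using mult.IH by blast
        then show ?thesis by (simp add: mult.assoc)
      qed simp
    qed
  next
    case (add u v)
    show ?case
    proof (intro allI impI)
      fix B assume B: "\<forall>x. v x + u x \<le> B"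
      have uv: "u x \<le> B" "v x \<le> B" for x
        using B[rule_format, of x] add(2)[of x] add(4)[of x] by linarith+
      then have eq: "(LINT x|M1. u x * g1 x) = (LINT x|M2. u x * g2 x)"
          "(LINT x|M1. v x * g1 x) = (LINT x|M2. v x * g2 x)"
        using add.IH by blast+
      have "(LINT x|M. (v x + u x) * g x) = (LINT x|M. v x * g x) + (LINT x|M. u x * g x)"
        if "(\<lambda>x. x) \<in> M \<rightarrow>\<^sub>M borel" "integrable M g" for M and g :: "real \<Rightarrow> real"
        using int[OF add(1,2) uv(1) that] int[OF add(3,4) uv(2) that] by (simp add: distrib_right)
      then show "(LINT x|M1. (v x + u x) * g1 x) = (LINT x|M2. (v x + u x) * g2 x)"
        using eq id1 id2 g1 g2 by simp
    qed
  next
    case (seq U)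
    have Ulim: "(\<lambda>i. U i x) \<longlonglongrightarrow> f x" for x using seq(4) by simp
    show ?case
    proof (intro allI impI)
      fix B assume B: "\<forall>x. f x \<le> B"
      have UB: "U i x \<le> B" for i x
        using incseq_le[OF _ Ulim, of x i] seq(3) B
        by (auto simp: incseq_def le_fun_def intro: order_trans)
      have lim: "(\<lambda>i. LINT x|M. U i x * g x) \<longlonglongrightarrow> (LINT x|M. f x * g x)"
        if id: "(\<lambda>x. x) \<in> M \<rightarrow>\<^sub>M borel" and g: "integrable M g" for M and g :: "real \<Rightarrow> real"
      proof (rule integral_dominated_convergence[where w = "\<lambda>x. B * \<bar>g x\<bar>"])
        show Um: "(\<lambda>x. U i x * g x) \<in> borel_measurable M" for i
          by (intro borel_measurable_integrable int[OF seq(1,2) UB id g])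
        show "AE x in M. (\<lambda>i. U i x * g x) \<longlonglongrightarrow> f x * g x"
          by (intro AE_I2 tendsto_mult Ulim tendsto_const)
        show "(\<lambda>x. f x * g x) \<in> borel_measurable M"
          using B by (intro borel_measurable_integrable int[OF assms(1,2) _ id g]) auto
        show "AE x in M. norm (U i x * g x) \<le> B * \<bar>g x\<bar>" for i
          using seq(2) UB by (intro AE_I2) (auto simp: abs_mult intro!: mult_right_mono)
      qed (use g in simp)
      have eq: "(LINT x|M1. U i x * g1 x) = (LINT x|M2. U i x * g2 x)" for i
        using seq.IH UB by blast
      show "(LINT x|M1. f x * g1 x) = (LINT x|M2. f x * g2 x)"
        by (rule LIMSEQ_unique[OF lim[OF id1 g1]]) (unfold eq, rule lim[OF id2 g2])
    qed
  qed
  then show ?thesis using assms(3) by blast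
qed

text \<open>
  Two signed measures with integrable densities on a bounded interval agree as soon as their moments
  agree. Equality propagates from polynomials to continuous functions, indicators of half-lines,
  indicators of Borel sets, and finally to bounded Borel functions.
\<close>

lemma moments_determine_density:
  assumes f: "f \<in> borel_measurable borel" and B: "\<And>x. \<bar>f x\<bar> \<le> B"
  shows "(LINT x|M1. f x * g1 x) = (LINT x|M2. f x * g2 x)"
proof -
  \<comment> \<open>Constants are moments, so \<open>f\<close> may be shifted to a nonnegative function.\<close>
  have nn: "0 \<le> f x + B" "f x + B \<le> 2 * B" for x using B[of x] by auto
  have m: "(\<lambda>x. f x + B) \<in> borel_measurable borel" using f by simp
  have "(LINT x|M. (f x + B) * g x) = (LINT x|M. f x * g x) + B * (LINT x|M. g x)"
    if "(\<lambda>x. x) \<in> M \<rightarrow>\<^sub>M borel" "integrable M g" for M and g :: "real \<Rightarrow> real"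
    using bounded_mult_integrable[OF that(1) f B that(2)] that(2) by (simp add: distrib_right)
  from this[OF id1 g1] this[OF id2 g2] show ?thesis
    using moments_nonneg[OF m nn] moments[of "[:1:]"] by simp
qed

end

section \<open>One-variable calculus\<close>

lemma tendsto_zero_inverse_bound:
  fixes s :: "nat \<Rightarrow> real"
  assumes "\<And>n. 0 \<le> s n" "\<And>n. s n \<le> c / real (Suc n)"
  shows "s \<longlonglongrightarrow> 0"
proof (rule real_tendsto_sandwich[OF _ _ tendsto_const LIMSEQ_Suc[OF lim_const_over_n[of c]]])
  show "\<forall>\<^sub>F n in sequentially. 0 \<le> s n"
    using assms(1) by (intro always_eventually allI)
  show "\<forall>\<^sub>F n in sequentially. s n \<le> c / real (Suc n)"
    by (intro always_eventually allI assms(2))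
qed

text \<open>
  The derivation of Euler equations: a minimum at \<open>s = 0\<close> kills the linear term.
\<close>

lemma quadratic_nonneg_linear_zero:
  fixes B C :: real
  assumes "\<And>s. 0 \<le> 2 * s * B + s\<^sup>2 * C"
  shows "B = 0"
proof (rule ccontr)
  assume B: "B \<noteq> 0"
  \<comment> \<open>At \<open>s = - B / K\<close> the linear term outweighs the quadratic one.\<close>
  define K where "K = \<bar>C\<bar> + 1"
  have K: "0 < K" "C < K" by (auto simp: K_def)
  have "2 * (- B / K) * B + (- B / K)\<^sup>2 * C = (B\<^sup>2 / K\<^sup>2) * (C - 2 * K)"
    using K(1) by (simp add: field_simps power2_eq_square)
  also have "\<dots> < 0"
    using B K by (intro mult_pos_neg) auto
  finally show False using assms[of "- B / K"] by linarith
qed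

lemma smooth_lincomb:
  assumes "f \<in> smooth_functions S" "g \<in> smooth_functions S"
  shows "(\<lambda>x. c * f x + d * g x) \<in> smooth_functions S"
proof -
  from assms obtain D E where D: "D 0 = f" "E 0 = g"
      "\<And>k x. x \<in> S \<Longrightarrow> (D k has_real_derivative D (Suc k) x) (at x within S)"
      "\<And>k x. x \<in> S \<Longrightarrow> (E k has_real_derivative E (Suc k) x) (at x within S)"
    unfolding smooth_functions_def by blast
  show ?thesis
    unfolding smooth_functions_def
    by (rule CollectI, rule exI[of _ "\<lambda>k x. c * D k x + d * E k x"])
      (auto simp: D(1,2) intro!: DERIV_add DERIV_cmult D(3,4))
qed

lemma poly_smooth: "poly p \<in> smooth_functions S"
  unfolding smooth_functions_def
  by (rule CollectI, rule exI[of _ "\<lambda>k. poly ((pderiv ^^ k) p)"])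
    (auto intro: DERIV_subset[OF poly_DERIV])

lemma deriv_poly: "deriv (poly p) x = poly (pderiv p) x" for x :: real
  by (rule DERIV_imp_deriv[OF poly_DERIV])

lemma poly_primitive: "\<exists>P. pderiv P = p" for p :: "real poly"
proof
  define P where "P = (\<Sum>i\<le>degree p. monom (coeff p i / real (Suc i)) (Suc i))"
  have pderiv_sum: "pderiv (\<Sum>i\<le>n. f i) = (\<Sum>i\<le>n. pderiv (f i))" for f :: "nat \<Rightarrow> real poly" and n
    using higher_pderiv_sum[of 1 f "{..n}"] by simp
  have "pderiv P = (\<Sum>i\<le>degree p. monom (coeff p i) i)"
    unfolding P_def pderiv_sum by (intro sum.cong) (auto simp: pderiv_monom simp del: of_nat_Suc)
  then show "pderiv P = p" by (simp add: poly_as_sum_of_monoms)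
qed

lemma integral_lebesgue_interval:
  fixes F f :: "real \<Rightarrow> real"
  assumes "c \<le> d" and F: "\<And>x. x \<in> {c..d} \<Longrightarrow> (F has_real_derivative f x) (at x within {c..d})"
    and f: "continuous_on {c..d} f"
  shows "(LINT x|lborel. indicator {c<..<d} x * f x) = F d - F c"
proof -
  have "(LINT x|lborel. indicator {c<..<d} x * f x) = (LINT x|lborel. indicator {c..d} x *\<^sub>R f x)"
  proof (rule integral_cong_AE)
    have "set_integrable lborel {c..d} f"
      by (rule borel_integrable_atLeastAtMost'[OF f])
    then show m: "(\<lambda>x. indicator {c..d} x *\<^sub>R f x) \<in> borel_measurable lborel"
      unfolding set_integrable_def by auto
    have "(\<lambda>x. indicat_real {c<..<d} x * (indicator {c..d} x *\<^sub>R f x)) \<in> borel_measurable lborel"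
      using m by (intro borel_measurable_times) auto
    also have "(\<lambda>x. indicat_real {c<..<d} x * (indicator {c..d} x *\<^sub>R f x)) = (\<lambda>x. indicator {c<..<d} x * f x)"
      by (auto simp: fun_eq_iff indicator_def)
    finally show "(\<lambda>x. indicator {c<..<d} x * f x) \<in> borel_measurable lborel" .
    show "AE x in lborel. indicator {c<..<d} x * f x = indicator {c..d} x *\<^sub>R f x"
      using AE_lborel_singleton[of c] AE_lborel_singleton[of d]
      by eventually_elim (auto simp: indicator_def)
  qed
  also have "\<dots> = F d - F c"
    using assms by (intro integral_FTC_atLeastAtMost) (auto simp: has_real_derivative_iff_has_vector_derivative)
  finally show ?thesis .
qed

text \<open>
  The diagonal argument, for bounds that depend on the point: dividing by them reduces to a uniform
  bound.
\<close>

lemma convergent_subsequence_on_bounded_points: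
  fixes f :: "nat \<Rightarrow> 'a \<Rightarrow> real"
  assumes "countable S" "\<And>x. x \<in> S \<Longrightarrow> \<exists>B. \<forall>n. \<bar>f n x\<bar> \<le> B"
  obtains k :: "nat \<Rightarrow> nat" where "strict_mono k" "\<And>x. x \<in> S \<Longrightarrow> convergent (\<lambda>n. f (k n) x)"
proof -
  obtain B where B: "\<And>x n. x \<in> S \<Longrightarrow> \<bar>f n x\<bar> \<le> B x"
    using assms(2) by metis
  define c where "c x = \<bar>B x\<bar> + 1" for x
  have c: "0 < c x" for x by (simp add: c_def)
  have "norm (f n x / c x) \<le> 1" if "x \<in> S" for n x
    using B[OF that, of n] by (simp add: c_def)
  then obtain k :: "nat \<Rightarrow> nat" where k: "strict_mono k"
      "\<And>x. x \<in> S \<Longrightarrow> \<exists>l. (\<lambda>n. f (k n) x / c x) \<longlonglongrightarrow> l"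
    using function_convergent_subsequence[OF assms(1), of "\<lambda>n x. f n x / c x" 1] by metis
  have "convergent (\<lambda>n. f (k n) x)" if x: "x \<in> S" for x
  proof -
    obtain l where "(\<lambda>n. f (k n) x / c x) \<longlonglongrightarrow> l" using k(2)[OF x] by blast
    then have "(\<lambda>n. c x * (f (k n) x / c x)) \<longlonglongrightarrow> c x * l" by (rule tendsto_mult_left)
    then show ?thesis using c[of x] by (auto simp: convergent_def)
  qed
  with k(1) show thesis by (rule that)
qed

section \<open>The closed graph of the gradient\<close>

text \<open>
  The projection theorem in an abstract form: \<open>J\<close> is a quadratic functional, \<open>d\<close> the squared distance
  that belongs to it and \<open>z\<close> the midpoint of \<open>x\<close> and \<open>y\<close>. By the parallelogram law minimising sequences
  are Cauchy. It is stated without a linear structure because elements of \<open>L\<^sup>2\<close>, and pairs of them, are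
  represented by functions.
\<close>

lemma parallelogram_minimum:
  fixes J :: "'a \<Rightarrow> real" and d :: "'a \<Rightarrow> 'a \<Rightarrow> real"
  assumes "K \<noteq> {}" and pos: "\<And>x. x \<in> K \<Longrightarrow> 0 \<le> J x"
    and mid: "\<And>x y. x \<in> K \<Longrightarrow> y \<in> K \<Longrightarrow> \<exists>z\<in>K. d x y \<le> 2 * J x + 2 * J y - 4 * J z"
    and complete: "\<And>X. (\<And>n. X n \<in> K) \<Longrightarrow>
      (\<And>e. 0 < e \<Longrightarrow> \<exists>N. \<forall>i\<ge>N. \<forall>j\<ge>N. d (X i) (X j) < e) \<Longrightarrow> \<exists>x\<in>K. (\<lambda>n. J (X n)) \<longlonglongrightarrow> J x"
  shows "\<exists>x\<in>K. \<forall>y\<in>K. J x \<le> J y"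
proof -
  define m where "m = Inf (J ` K)"
  have bdd: "bdd_below (J ` K)" using pos by (auto intro!: bdd_belowI[of _ 0])
  have m_le: "m \<le> J x" if "x \<in> K" for x
    unfolding m_def using bdd that by (auto intro: cInf_lower)
  have "\<exists>x\<in>K. J x < m + 1 / real (Suc n)" for n
    using cInf_lessD[of "J ` K" "m + 1 / real (Suc n)"] assms(1) unfolding m_def by auto
  then obtain X where X: "\<And>n. X n \<in> K" "\<And>n. J (X n) < m + 1 / real (Suc n)"
    by metis
  have "\<exists>N. \<forall>i\<ge>N. \<forall>j\<ge>N. d (X i) (X j) < e" if e: "0 < e" for e
  proof -
    obtain N where N: "1 / real (Suc N) < e / 4"
      using e nat_approx_posE[of "e / 4"] by auto
    have "d (X i) (X j) < e" if "i \<ge> N" "j \<ge> N" for i j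
    proof -
      obtain z where z: "z \<in> K" "d (X i) (X j) \<le> 2 * J (X i) + 2 * J (X j) - 4 * J z"
        using mid X(1) by blast
      have "1 / real (Suc i) \<le> 1 / real (Suc N)" "1 / real (Suc j) \<le> 1 / real (Suc N)"
        using that by (auto intro!: divide_left_mono)
      then show ?thesis
        using X(2)[of i] X(2)[of j] m_le[OF z(1)] z(2) N by linarith
    qed
    then show ?thesis by blast
  qed
  then obtain x where x: "x \<in> K" "(\<lambda>n. J (X n)) \<longlonglongrightarrow> J x"
    using complete[of X] X(1) by blast
  have "(\<lambda>n. m + 1 / real (Suc n)) \<longlonglongrightarrow> m + 0"
    by (intro tendsto_intros LIMSEQ_Suc[OF lim_1_over_n])
  then have "J x \<le> m + 0"
    using x(2) X(2) by (intro LIMSEQ_le[of "\<lambda>n. J (X n)"]) (auto intro: less_imp_le)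
  then show ?thesis
    using x(1) m_le by (intro bexI[of _ x]) (auto intro: order_trans)
qed

locale interval_measure = finite_measure M for M :: "real measure" +
  fixes a b :: real
  assumes ab: "a < b" and sets_M: "sets M = sets (restrict_space borel {a<..<b})"
begin

lemma finite_M: "finite_measure M"
  by unfold_locales

lemma space_M: "space M = {a<..<b}"
  using sets_eq_imp_space_eq[OF sets_M] by simp

lemma closure_space: "closure (space M) = {a..b}"
  using ab by (simp add: space_M)

lemma measurable_id: "(\<lambda>x. x) \<in> M \<rightarrow>\<^sub>M borel"
  by (subst measurable_cong_sets[OF sets_M refl]) (auto intro: measurable_restrict_space1)

lemma continuous_on_measurable:
  assumes "continuous_on {a..b} f"
  shows "f \<in> borel_measurable M"
proof -
  have "f \<in> borel_measurable (restrict_space borel {a<..<b})"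
    by (intro borel_measurable_continuous_on_restrict continuous_on_subset[OF assms]) auto
  then show ?thesis
    by (subst measurable_cong_sets[OF sets_M refl])
qed

lemma continuous_on_L2:
  assumes "continuous_on {a..b} f"
  shows "f \<in> L2 M"
proof -
  have "compact (f ` {a..b})" by (intro compact_continuous_image assms) simp
  then obtain B where "\<And>x. x \<in> {a..b} \<Longrightarrow> \<bar>f x\<bar> \<le> B"
    using compact_imp_bounded[of "f ` {a..b}"] unfolding bounded_iff real_norm_def by (meson imageI)
  then show ?thesis
    using continuous_on_measurable[OF assms]
    by (intro L2_bounded[OF finite_M, of _ B]) (auto simp: space_M)
qed

text \<open>
  The one-sided derivative \<open>g\<close> is continuous up to the end points; there \<open>deriv f\<close> depends on the values
  of \<open>f\<close> outside the interval, so the two need to agree only in the interior.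
\<close>

lemma smooth_continuous_derivative:
  assumes "f \<in> smooth_functions {a..b}"
  obtains g where "continuous_on {a..b} g"
    "\<And>x. x \<in> {a..b} \<Longrightarrow> (f has_real_derivative g x) (at x within {a..b})"
    "\<And>x. x \<in> {a<..<b} \<Longrightarrow> deriv f x = g x"
proof -
  from assms obtain D where D: "D 0 = f"
      "\<And>k x. x \<in> {a..b} \<Longrightarrow> (D k has_real_derivative D (Suc k) x) (at x within {a..b})"
    by (auto simp: smooth_functions_def)
  have "continuous_on {a..b} (D 1)"
    using D(2)[of _ 1] by (intro DERIV_continuous_on) auto
  moreover have der: "(f has_real_derivative D 1 x) (at x within {a..b})" if "x \<in> {a..b}" for x
    using D(2)[OF that, of 0] D(1) by simp
  moreover have "deriv f x = D 1 x" if "x \<in> {a<..<b}" for x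
  proof -
    have "at x within {a..b} = at x"
      using that by (intro at_within_interior) auto
    then show ?thesis
      using der[of x] that by (auto intro: DERIV_imp_deriv)
  qed
  ultimately show thesis by (rule that)
qed

lemma smooth_continuous_on:
  assumes "f \<in> smooth_functions {a..b}"
  shows "continuous_on {a..b} f"
  using smooth_continuous_derivative[OF assms] by (metis DERIV_continuous_on)

lemma smooth_L2:
  assumes "f \<in> smooth_functions {a..b}"
  shows "f \<in> L2 M" "deriv f \<in> L2 M"
proof -
  show "f \<in> L2 M"
    using assms by (intro continuous_on_L2 smooth_continuous_on)
  obtain g where g: "continuous_on {a..b} g" "\<And>x. x \<in> {a<..<b} \<Longrightarrow> deriv f x = g x"
    using smooth_continuous_derivative[OF assms] by metis
  have "g \<in> L2 M" by (intro continuous_on_L2 g)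
  moreover have "deriv f \<in> borel_measurable M \<longleftrightarrow> g \<in> borel_measurable M"
    by (intro measurable_cong) (simp add: g space_M)
  moreover have "integrable M (\<lambda>x. (deriv f x)\<^sup>2) \<longleftrightarrow> integrable M (\<lambda>x. (g x)\<^sup>2)"
    by (intro Bochner_Integration.integrable_cong) (auto simp: g space_M)
  ultimately show "deriv f \<in> L2 M"
    by (simp add: L2_def)
qed

lemma deriv_lincomb:
  assumes "f \<in> smooth_functions {a..b}" "g \<in> smooth_functions {a..b}" "x \<in> {a<..<b}"
  shows "deriv (\<lambda>x. c * f x + d * g x) x = c * deriv f x + d * deriv g x"
proof -
  have *: "(h has_real_derivative deriv h x) (at x)" if h: "h \<in> smooth_functions {a..b}" for h
  proof -
    obtain h' where h': "\<And>x. x \<in> {a..b} \<Longrightarrow> (h has_real_derivative h' x) (at x within {a..b})"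
        "\<And>x. x \<in> {a<..<b} \<Longrightarrow> deriv h x = h' x"
      using smooth_continuous_derivative[OF h] by metis
    have "at x within {a..b} = at x"
      using assms(3) by (intro at_within_interior) auto
    then show ?thesis
      using h'(1)[of x] h'(2)[of x] assms(3) by simp
  qed
  show ?thesis
    by (intro DERIV_imp_deriv DERIV_add DERIV_cmult * assms)
qed

text \<open>
  \<open>(u, v)\<close> lies in the closure of the graph of the derivative on smooth functions. In this form the
  graph is visibly closed and linear; with sequences, closedness would take a diagonal argument.
\<close>

lemma gradients_iff:
  "v \<in> gradients M u \<longleftrightarrow> u \<in> L2 M \<and> v \<in> L2 M \<and>
    (\<forall>e>0. \<exists>\<phi>\<in>smooth_functions {a..b}.
      (LINT x|M. (\<phi> x - u x)\<^sup>2) < e \<and> (LINT x|M. (deriv \<phi> x - v x)\<^sup>2) < e)"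
  (is "?L \<longleftrightarrow> ?R")
proof
  assume ?L
  then obtain \<phi> where \<phi>: "\<And>n. \<phi> n \<in> smooth_functions {a..b}" "v \<in> L2 M" "u \<in> L2 M"
      "(\<lambda>n. LINT x|M. (\<phi> n x - u x)\<^sup>2) \<longlonglongrightarrow> 0"
      "(\<lambda>n. LINT x|M. (deriv (\<phi> n) x - v x)\<^sup>2) \<longlonglongrightarrow> 0"
    by (auto simp: gradients_def L2_tendsto_iff closure_space)
  have "\<exists>\<phi>\<in>smooth_functions {a..b}.
      (LINT x|M. (\<phi> x - u x)\<^sup>2) < e \<and> (LINT x|M. (deriv \<phi> x - v x)\<^sup>2) < e" if "0 < e" for e
  proof -
    have "\<forall>\<^sub>F n in sequentially. (LINT x|M. (\<phi> n x - u x)\<^sup>2) < e \<and>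
        (LINT x|M. (deriv (\<phi> n) x - v x)\<^sup>2) < e"
      by (rule eventually_conj[OF order_tendstoD(2)[OF \<phi>(4) that] order_tendstoD(2)[OF \<phi>(5) that]])
    then show ?thesis
      using eventually_happens'[OF sequentially_bot] \<phi>(1) by fast
  qed
  with \<phi> show ?R by blast
next
  assume R: ?R
  then have approx: "\<exists>\<phi>. \<phi> \<in> smooth_functions {a..b} \<and> (LINT x|M. (\<phi> x - u x)\<^sup>2) < e \<and>
      (LINT x|M. (deriv \<phi> x - v x)\<^sup>2) < e" if "0 < e" for e
    using that by blast
  have "\<forall>n. \<exists>\<phi>. \<phi> \<in> smooth_functions {a..b} \<and> (LINT x|M. (\<phi> x - u x)\<^sup>2) < 1 / real (Suc n) \<and>
      (LINT x|M. (deriv \<phi> x - v x)\<^sup>2) < 1 / real (Suc n)"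
    by (intro allI approx) simp
  from choice[OF this] obtain \<phi> where \<phi>: "\<And>n. \<phi> n \<in> smooth_functions {a..b}"
      "\<And>n. (LINT x|M. (\<phi> n x - u x)\<^sup>2) < 1 / real (Suc n)"
      "\<And>n. (LINT x|M. (deriv (\<phi> n) x - v x)\<^sup>2) < 1 / real (Suc n)"
    by blast
  have "(\<lambda>n. LINT x|M. (\<phi> n x - u x)\<^sup>2) \<longlonglongrightarrow> 0"
    by (rule tendsto_zero_inverse_bound[OF _ less_imp_le[OF \<phi>(2)]]) simp
  moreover have "(\<lambda>n. LINT x|M. (deriv (\<phi> n) x - v x)\<^sup>2) \<longlonglongrightarrow> 0"
    by (rule tendsto_zero_inverse_bound[OF _ less_imp_le[OF \<phi>(3)]]) simp
  ultimately show ?L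
    using R \<phi>(1) smooth_L2[OF \<phi>(1)]
    by (auto simp: gradients_def L2_tendsto_iff closure_space)
qed

lemma gradients_L2: "v \<in> gradients M u \<Longrightarrow> u \<in> L2 M" "v \<in> gradients M u \<Longrightarrow> v \<in> L2 M"
  by (auto simp: gradients_iff)

lemma smooth_gradient: "\<phi> \<in> smooth_functions {a..b} \<Longrightarrow> deriv \<phi> \<in> gradients M \<phi>"
  unfolding gradients_iff using smooth_L2 by (auto intro!: bexI[of _ \<phi>])

lemma gradients_lincomb:
  assumes "v \<in> gradients M u" "v' \<in> gradients M u'"
  shows "(\<lambda>x. c * v x + d * v' x) \<in> gradients M (\<lambda>x. c * u x + d * u' x)"
  unfolding gradients_iff
proof (intro conjI allI impI)
  note L2 = gradients_L2[OF assms(1)] gradients_L2[OF assms(2)]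
  show "(\<lambda>x. c * u x + d * u' x) \<in> L2 M" "(\<lambda>x. c * v x + d * v' x) \<in> L2 M"
    using L2 by (auto intro: L2_lincomb)
  fix e :: real assume e: "0 < e"
  define C where "C = 2 * c\<^sup>2 + 2 * d\<^sup>2 + 1"
  have C: "0 < C" unfolding C_def by (simp add: add_nonneg_pos)
  have eC: "0 < e / C" using e C by simp
  obtain \<phi> where \<phi>: "\<phi> \<in> smooth_functions {a..b}"
      "(LINT x|M. (\<phi> x - u x)\<^sup>2) < e / C" "(LINT x|M. (deriv \<phi> x - v x)\<^sup>2) < e / C"
    using assms(1) eC unfolding gradients_iff by blast
  obtain \<psi> where \<psi>: "\<psi> \<in> smooth_functions {a..b}"
      "(LINT x|M. (\<psi> x - u' x)\<^sup>2) < e / C" "(LINT x|M. (deriv \<psi> x - v' x)\<^sup>2) < e / C"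
    using assms(2) eC unfolding gradients_iff by blast
  have close: "(LINT x|M. (c * f x + d * g x - (c * f' x + d * g' x))\<^sup>2) < e"
    if "f \<in> L2 M" "g \<in> L2 M" "f' \<in> L2 M" "g' \<in> L2 M"
      "(LINT x|M. (f x - f' x)\<^sup>2) < e / C" "(LINT x|M. (g x - g' x)\<^sup>2) < e / C" for f g f' g'
  proof -
    have "(LINT x|M. (c * f x + d * g x - (c * f' x + d * g' x))\<^sup>2)
        = (LINT x|M. (c * (f x - f' x) + d * (g x - g' x))\<^sup>2)"
      by (simp add: algebra_simps)
    also have "\<dots> \<le> 2 * (LINT x|M. (c * (f x - f' x))\<^sup>2) + 2 * (LINT x|M. (d * (g x - g' x))\<^sup>2)"
      by (intro L2_sq_triangle L2_cmult L2_diff that)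
    also have "\<dots> = 2 * c\<^sup>2 * (LINT x|M. (f x - f' x)\<^sup>2) + 2 * d\<^sup>2 * (LINT x|M. (g x - g' x)\<^sup>2)"
      by (simp add: power_mult_distrib)
    also have "\<dots> \<le> 2 * c\<^sup>2 * (e / C) + 2 * d\<^sup>2 * (e / C)"
      using that by (intro add_mono mult_left_mono) auto
    also have "\<dots> < C * (e / C)"
    proof -
      have "2 * c\<^sup>2 * k + 2 * d\<^sup>2 * k < (2 * c\<^sup>2 + 2 * d\<^sup>2 + 1) * k" if "0 < k" for k
        using that by (simp add: algebra_simps)
      then show ?thesis using eC unfolding C_def by blast
    qed
    finally show ?thesis using C by simp
  qed
  have "(LINT x|M. (deriv (\<lambda>x. c * \<phi> x + d * \<psi> x) x - (c * v x + d * v' x))\<^sup>2)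
      = (LINT x|M. (c * deriv \<phi> x + d * deriv \<psi> x - (c * v x + d * v' x))\<^sup>2)"
    by (intro Bochner_Integration.integral_cong)
      (auto simp: space_M deriv_lincomb[OF \<phi>(1) \<psi>(1)])
  then show "\<exists>\<theta>\<in>smooth_functions {a..b}. (LINT x|M. (\<theta> x - (c * u x + d * u' x))\<^sup>2) < e \<and>
      (LINT x|M. (deriv \<theta> x - (c * v x + d * v' x))\<^sup>2) < e"
    using \<phi> \<psi> L2 by (intro bexI[of _ "\<lambda>x. c * \<phi> x + d * \<psi> x"] smooth_lincomb)
      (auto intro!: close smooth_L2)
qed

text \<open>
  A closure is closed. With \<open>u n = u'\<close> this says that each \<open>\<Gamma>(u')\<close> is closed.
\<close>

lemma gradients_closed:
  assumes v: "\<And>n. v n \<in> gradients M (u n)" and L2: "u' \<in> L2 M" "v' \<in> L2 M"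
    and lim: "(\<lambda>n. LINT x|M. (u n x - u' x)\<^sup>2) \<longlonglongrightarrow> 0" "(\<lambda>n. LINT x|M. (v n x - v' x)\<^sup>2) \<longlonglongrightarrow> 0"
  shows "v' \<in> gradients M u'"
  unfolding gradients_iff
proof (intro conjI allI impI L2)
  fix e :: real assume e: "0 < e"
  then have e4: "0 < e / 4" by simp
  obtain n where n: "(LINT x|M. (u n x - u' x)\<^sup>2) < e / 4" "(LINT x|M. (v n x - v' x)\<^sup>2) < e / 4"
    using eventually_happens'[OF sequentially_bot eventually_conj[OF order_tendstoD(2)[OF lim(1) e4]
        order_tendstoD(2)[OF lim(2) e4]]] by fast
  obtain \<phi> where \<phi>: "\<phi> \<in> smooth_functions {a..b}"
      "(LINT x|M. (\<phi> x - u n x)\<^sup>2) < e / 4" "(LINT x|M. (deriv \<phi> x - v n x)\<^sup>2) < e / 4"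
    using v[of n] e4 unfolding gradients_iff by blast
  show "\<exists>\<phi>\<in>smooth_functions {a..b}. (LINT x|M. (\<phi> x - u' x)\<^sup>2) < e \<and>
      (LINT x|M. (deriv \<phi> x - v' x)\<^sup>2) < e"
    using L2_sq_triangle3[OF smooth_L2(1)[OF \<phi>(1)] gradients_L2(1)[OF v[of n]] L2(1)]
      L2_sq_triangle3[OF smooth_L2(2)[OF \<phi>(1)] gradients_L2(2)[OF v[of n]] L2(2)] n \<phi>
    by (intro bexI[of _ \<phi>]) linarith+
qed

text \<open>
  The choice in the definition is meaningful: a gradient of minimal norm exists, because \<open>\<Gamma>(u)\<close> is
  convex and closed.
\<close>

lemma tangential_gradient_in_gradients:
  assumes "u \<in> H1 M"
  shows "tangential_gradient M u \<in> gradients M u"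
proof -
  have "\<exists>v\<in>gradients M u. \<forall>y\<in>gradients M u. (LINT x|M. (v x)\<^sup>2) \<le> (LINT x|M. (y x)\<^sup>2)"
  proof (rule parallelogram_minimum[where d = "\<lambda>v y. LINT x|M. (v x - y x)\<^sup>2"])
    show "gradients M u \<noteq> {}" using assms by (simp add: H1_def)
    show "\<exists>z\<in>gradients M u. (LINT t|M. (v t - y t)\<^sup>2) \<le> 2 * (LINT t|M. (v t)\<^sup>2) + 2 * (LINT t|M. (y t)\<^sup>2)
        - 4 * (LINT t|M. (z t)\<^sup>2)" if "v \<in> gradients M u" "y \<in> gradients M u" for v y
      using gradients_lincomb[OF that, of "1/2" "1/2"] L2_parallelogram[of v M y] gradients_L2(2) that
      by (intro bexI[of _ "\<lambda>x. 1/2 * v x + 1/2 * y x"]) auto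
    show "\<exists>v\<in>gradients M u. (\<lambda>n. LINT x|M. (X n x)\<^sup>2) \<longlonglongrightarrow> (LINT x|M. (v x)\<^sup>2)"
      if X: "\<And>n. X n \<in> gradients M u"
        and Cauchy: "\<And>e. 0 < e \<Longrightarrow> \<exists>N. \<forall>i\<ge>N. \<forall>j\<ge>N. (LINT x|M. (X i x - X j x)\<^sup>2) < e" for X
    proof -
      have XL2: "X n \<in> L2 M" for n using X by (rule gradients_L2)
      obtain v where v: "v \<in> L2 M" "(\<lambda>n. LINT x|M. (X n x - v x)\<^sup>2) \<longlonglongrightarrow> 0"
        using L2_complete[OF finite_M XL2 Cauchy] by blast
      have "v \<in> gradients M u"
        using gradients_closed[OF X gradients_L2(1)[OF X] v(1) _ v(2)] by simp
      then show ?thesis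
        using L2_sq_tendsto[OF XL2 v] by blast
    qed
  qed simp
  then obtain v where v: "is_arg_min (L2_norm M) (\<lambda>v. v \<in> gradients M u) v"
    unfolding is_arg_min_linorder L2_norm_eq by auto
  then show ?thesis
    unfolding tangential_gradient_def arg_min_def by (metis (mono_tags, lifting) is_arg_min_def someI)
qed

section \<open>Approximating the projection by the domain of the adjoint\<close>

text \<open>
  For \<open>t > 0\<close> its minimiser over the closed graph is the projection of the pair \<open>(0, 1)\<close>, with respect
  to the norm that gives weight \<open>t\<close> to the first component. A large \<open>t\<close> forces \<open>u\<close> to \<open>0\<close>, hence \<open>v\<close>
  towards \<open>\<Gamma>(0)\<close>.
\<close>

definition resolvent_energy :: "real \<Rightarrow> (real \<Rightarrow> real) \<times> (real \<Rightarrow> real) \<Rightarrow> real"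
  where "resolvent_energy t p = t * (LINT x|M. (fst p x)\<^sup>2) + (LINT x|M. (snd p x - 1)\<^sup>2)"

definition gradient_graph :: "((real \<Rightarrow> real) \<times> (real \<Rightarrow> real)) set"
  where "gradient_graph = {(u, v). v \<in> gradients M u}"

lemma const_L2: "(\<lambda>x. c) \<in> L2 M"
  by (rule L2_const[OF finite_M])

lemma zero_gradient: "(\<lambda>x. 0) \<in> gradients M (\<lambda>x. 0)"
proof -
  have "poly (0::real poly) = (\<lambda>x. 0)" by (simp add: fun_eq_iff)
  then have "(\<lambda>x::real. 0::real) \<in> smooth_functions {a..b}"
    using poly_smooth[of 0 "{a..b}"] by metis
  moreover have "deriv (\<lambda>x::real. 0::real) = (\<lambda>x. 0)" by (simp add: fun_eq_iff)
  ultimately show ?thesis using smooth_gradient by metis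
qed

lemma resolvent_parallelogram:
  assumes "p \<in> gradient_graph" "q \<in> gradient_graph"
  shows "\<exists>z\<in>gradient_graph. t * (LINT x|M. (fst p x - fst q x)\<^sup>2) + (LINT x|M. (snd p x - snd q x)\<^sup>2)
    = 2 * resolvent_energy t p + 2 * resolvent_energy t q - 4 * resolvent_energy t z"
proof -
  obtain u v u' v' where pq: "p = (u, v)" "q = (u', v')" by (metis prod.exhaust)
  have g: "v \<in> gradients M u" "v' \<in> gradients M u'"
    using assms by (auto simp: pq gradient_graph_def)
  note L2 = gradients_L2[OF g(1)] gradients_L2[OF g(2)]
  define z where "z = (\<lambda>x. 1/2 * u x + 1/2 * u' x, \<lambda>x. 1/2 * v x + 1/2 * v' x)"
  have z: "z \<in> gradient_graph"
    using gradients_lincomb[OF g, of "1/2" "1/2"] by (simp add: gradient_graph_def z_def)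
  have 1: "(LINT x|M. (u x - u' x)\<^sup>2) = 2 * (LINT x|M. (u x)\<^sup>2) + 2 * (LINT x|M. (u' x)\<^sup>2)
      - 4 * (LINT x|M. (1/2 * u x + 1/2 * u' x)\<^sup>2)"
    by (intro L2_parallelogram L2)
  have "(LINT x|M. ((v x - 1) - (v' x - 1))\<^sup>2) = 2 * (LINT x|M. (v x - 1)\<^sup>2) + 2 * (LINT x|M. (v' x - 1)\<^sup>2)
      - 4 * (LINT x|M. (1/2 * (v x - 1) + 1/2 * (v' x - 1))\<^sup>2)"
    by (intro L2_parallelogram L2_diff L2 const_L2)
  moreover have "1/2 * (v x - 1) + 1/2 * (v' x - 1) = 1/2 * v x + 1/2 * v' x - 1" for x
    by (simp add: field_simps)
  ultimately have 2: "(LINT x|M. (v x - v' x)\<^sup>2) = 2 * (LINT x|M. (v x - 1)\<^sup>2) + 2 * (LINT x|M. (v' x - 1)\<^sup>2)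
      - 4 * (LINT x|M. (1/2 * v x + 1/2 * v' x - 1)\<^sup>2)"
    by simp
  show ?thesis
    unfolding pq
    by (rule bexI[OF _ z]) (simp only: resolvent_energy_def z_def fst_conv snd_conv 1 2, simp only: algebra_simps)
qed

lemma resolvent_energy_nonneg: "0 \<le> t \<Longrightarrow> 0 \<le> resolvent_energy t p"
  by (simp add: resolvent_energy_def)

text \<open>
  The lower bound on \<open>t\<close> makes the energy control the first component as well.
\<close>

lemma resolvent_exists:
  assumes t: "1 \<le> t"
  shows "\<exists>p\<in>gradient_graph. \<forall>q\<in>gradient_graph. resolvent_energy t p \<le> resolvent_energy t q"
proof (rule parallelogram_minimum[where d =
      "\<lambda>p q. t * (LINT x|M. (fst p x - fst q x)\<^sup>2) + (LINT x|M. (snd p x - snd q x)\<^sup>2)"])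
  have "(\<lambda>x. 0, \<lambda>x. 0) \<in> gradient_graph"
    using zero_gradient by (simp add: gradient_graph_def)
  then show "gradient_graph \<noteq> {}" by blast
  show "\<exists>z\<in>gradient_graph. t * (LINT x|M. (fst p x - fst q x)\<^sup>2) + (LINT x|M. (snd p x - snd q x)\<^sup>2)
      \<le> 2 * resolvent_energy t p + 2 * resolvent_energy t q - 4 * resolvent_energy t z"
    if pq: "p \<in> gradient_graph" "q \<in> gradient_graph" for p q
  proof -
    obtain z where "z \<in> gradient_graph"
        "t * (LINT x|M. (fst p x - fst q x)\<^sup>2) + (LINT x|M. (snd p x - snd q x)\<^sup>2)
          = 2 * resolvent_energy t p + 2 * resolvent_energy t q - 4 * resolvent_energy t z"
      using resolvent_parallelogram[OF pq] by blast
    then show ?thesis by (intro bexI[of _ z] eq_refl)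
  qed
  show "\<exists>p\<in>gradient_graph. (\<lambda>n. resolvent_energy t (X n)) \<longlonglongrightarrow> resolvent_energy t p"
    if X: "\<And>n. X n \<in> gradient_graph"
      and Cauchy: "\<And>e. 0 < e \<Longrightarrow> \<exists>N. \<forall>i\<ge>N. \<forall>j\<ge>N. t * (LINT x|M. (fst (X i) x - fst (X j) x)\<^sup>2)
        + (LINT x|M. (snd (X i) x - snd (X j) x)\<^sup>2) < e" for X
  proof -
    have g: "snd (X n) \<in> gradients M (fst (X n))" for n
      using X[of n] by (auto simp: gradient_graph_def)
    note L2 = gradients_L2[OF g]
    have split: "(LINT x|M. (fst (X i) x - fst (X j) x)\<^sup>2) < e \<and> (LINT x|M. (snd (X i) x - snd (X j) x)\<^sup>2) < e"
      if "t * (LINT x|M. (fst (X i) x - fst (X j) x)\<^sup>2)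
        + (LINT x|M. (snd (X i) x - snd (X j) x)\<^sup>2) < e" for i j e
    proof -
      have "1 * (LINT x|M. (fst (X i) x - fst (X j) x)\<^sup>2) \<le> t * (LINT x|M. (fst (X i) x - fst (X j) x)\<^sup>2)"
        using t by (intro mult_right_mono) auto
      moreover have "0 \<le> (LINT x|M. (fst (X i) x - fst (X j) x)\<^sup>2)" "0 \<le> (LINT x|M. (snd (X i) x - snd (X j) x)\<^sup>2)"
        by simp_all
      ultimately show ?thesis using that by linarith
    qed
    have C1: "\<exists>N. \<forall>i\<ge>N. \<forall>j\<ge>N. (LINT x|M. (fst (X i) x - fst (X j) x)\<^sup>2) < e" if "0 < e" for e
      using Cauchy[OF that] split by meson
    have C2: "\<exists>N. \<forall>i\<ge>N. \<forall>j\<ge>N. (LINT x|M. (snd (X i) x - snd (X j) x)\<^sup>2) < e" if "0 < e" for e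
      using Cauchy[OF that] split by meson
    obtain u where u: "u \<in> L2 M" "(\<lambda>n. LINT x|M. (fst (X n) x - u x)\<^sup>2) \<longlonglongrightarrow> 0"
      using L2_complete[OF finite_M L2(1) C1] by blast
    obtain v where v: "v \<in> L2 M" "(\<lambda>n. LINT x|M. (snd (X n) x - v x)\<^sup>2) \<longlonglongrightarrow> 0"
      using L2_complete[OF finite_M L2(2) C2] by blast
    have "(u, v) \<in> gradient_graph"
      using gradients_closed[OF g u(1) v(1) u(2) v(2)] by (simp add: gradient_graph_def)
    moreover have "(\<lambda>n. LINT x|M. (fst (X n) x)\<^sup>2) \<longlonglongrightarrow> (LINT x|M. (u x)\<^sup>2)"
      by (rule L2_sq_tendsto[OF L2(1) u])
    moreover have "(\<lambda>n. LINT x|M. (snd (X n) x - 1)\<^sup>2) \<longlonglongrightarrow> (LINT x|M. (v x - 1)\<^sup>2)"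
      using v(2) by (intro L2_sq_tendsto L2_diff L2(2) v(1) const_L2) simp
    ultimately show ?thesis
      unfolding resolvent_energy_def
      by (intro bexI[of _ "(u, v)"]) (auto intro!: tendsto_add tendsto_mult_left)
  qed
qed (use t in \<open>simp add: resolvent_energy_nonneg\<close>)

text \<open>
  The Euler equation of the minimisation. For smooth \<open>f\<close> and \<open>h = f'\<close> it says that \<open>1 - v\<close> lies in the
  domain of the adjoint of the derivative, with image \<open>t u\<close>.
\<close>

lemma resolvent_euler:
  assumes p: "(u, v) \<in> gradient_graph"
    and min: "\<And>q. q \<in> gradient_graph \<Longrightarrow> resolvent_energy t (u, v) \<le> resolvent_energy t q"
    and q: "h \<in> gradients M f"
  shows "t * (LINT x|M. u x * f x) = (LINT x|M. (1 - v x) * h x)"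
proof -
  have v: "v \<in> gradients M u" using p by (simp add: gradient_graph_def)
  note L2 = gradients_L2[OF v] gradients_L2[OF q]
  have v1: "(\<lambda>x. v x - 1) \<in> L2 M" by (intro L2_diff L2 const_L2)
  have expand: "(LINT x|M. (f1 x + s * f2 x)\<^sup>2) =
      (LINT x|M. (f1 x)\<^sup>2) + 2 * s * (LINT x|M. f1 x * f2 x) + s\<^sup>2 * (LINT x|M. (f2 x)\<^sup>2)"
    if f: "f1 \<in> L2 M" "f2 \<in> L2 M" for f1 f2 s
  proof -
    have "(LINT x|M. (f1 x + s * f2 x)\<^sup>2) =
        (LINT x|M. (f1 x)\<^sup>2 + 2 * s * (f1 x * f2 x) + s\<^sup>2 * (f2 x)\<^sup>2)"
      by (intro Bochner_Integration.integral_cong) (auto simp: power2_eq_square algebra_simps)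
    also have "\<dots> = (LINT x|M. (f1 x)\<^sup>2) + 2 * s * (LINT x|M. f1 x * f2 x) + s\<^sup>2 * (LINT x|M. (f2 x)\<^sup>2)"
      using L2_mult_integrable[OF f] L2_sq_integrable[OF f(1)] L2_sq_integrable[OF f(2)] by simp
    finally show ?thesis .
  qed
  have "t * (LINT x|M. u x * f x) + (LINT x|M. (v x - 1) * h x) = 0"
  proof (rule quadratic_nonneg_linear_zero)
    fix s
    have "(\<lambda>x. u x + s * f x, \<lambda>x. v x + s * h x) \<in> gradient_graph"
      using gradients_lincomb[OF v q, of 1 s] by (simp add: gradient_graph_def)
    from min[OF this]
    have "t * (LINT x|M. (u x)\<^sup>2) + (LINT x|M. (v x - 1)\<^sup>2)
        \<le> t * (LINT x|M. (u x + s * f x)\<^sup>2) + (LINT x|M. ((v x - 1) + s * h x)\<^sup>2)"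
      by (simp add: resolvent_energy_def algebra_simps)
    then show "0 \<le> 2 * s * (t * (LINT x|M. u x * f x) + (LINT x|M. (v x - 1) * h x))
        + s\<^sup>2 * (t * (LINT x|M. (f x)\<^sup>2) + (LINT x|M. (h x)\<^sup>2))"
      by (simp only: expand[OF L2(1,3)] expand[OF v1 L2(4)]) (simp add: algebra_simps)
  qed
  moreover have "(LINT x|M. (1 - v x) * h x) = - (LINT x|M. (v x - 1) * h x)"
    by (subst Bochner_Integration.integral_minus[symmetric])
      (auto intro!: Bochner_Integration.integral_cong simp: algebra_simps)
  ultimately show ?thesis by linarith
qed

text \<open>
  The projection \<open>v\<close> of \<open>1\<close> onto \<open>\<Gamma>(0)\<close> is obtained together with fields \<open>w n\<close> in the domain of the
  adjoint that converge to \<open>1 - v\<close>. Let \<open>(u n, v n)\<close> minimise the energy with parameter \<open>t n\<close>. The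
  minimal energies increase with \<open>t\<close> and are bounded by the energy of \<open>(0, 0)\<close>, so they converge, and
  by the parallelogram law the \<open>v n\<close> form a Cauchy sequence. Moreover \<open>t n \<parallel>u n\<parallel>\<^sup>2\<close> is bounded, so
  \<open>u n\<close> tends to \<open>0\<close> and the limit of \<open>v n\<close> is in \<open>\<Gamma>(0)\<close>. Testing the Euler equation with \<open>(0, g)\<close>
  shows that \<open>1 - v n\<close>, and therefore its limit, is orthogonal to \<open>\<Gamma>(0)\<close>.
\<close>

lemma projection_approximation:
  obtains w h :: "nat \<Rightarrow> real \<Rightarrow> real" and v where
    "\<And>n. w n \<in> L2 M" "\<And>n. h n \<in> L2 M"
    "\<And>n \<phi>. \<phi> \<in> smooth_functions {a..b} \<Longrightarrow>
      (LINT x|M. deriv \<phi> x * w n x) = (LINT x|M. \<phi> x * h n x)"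
    "(\<lambda>n. LINT x|M. (w n x - (1 - v x))\<^sup>2) \<longlonglongrightarrow> 0"
    "v \<in> gradients M (\<lambda>x. 0)"
    "\<And>g. g \<in> gradients M (\<lambda>x. 0) \<Longrightarrow> (LINT x|M. (1 - v x) * g x) = 0"
proof -
  define t where "t n = real (Suc n)" for n
  have t: "1 \<le> t n" for n by (simp add: t_def)
  obtain p where p: "\<And>n. p n \<in> gradient_graph"
      "\<And>n q. q \<in> gradient_graph \<Longrightarrow> resolvent_energy (t n) (p n) \<le> resolvent_energy (t n) q"
    using resolvent_exists[OF t] by metis
  define u v where "u n = fst (p n)" and "v n = snd (p n)" for n
  have puv: "p n = (u n, v n)" for n by (simp add: u_def v_def)
  have g: "v n \<in> gradients M (u n)" for n
    using p(1)[of n] by (simp add: puv gradient_graph_def)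
  note L2 = gradients_L2[OF g]
  define m where "m n = resolvent_energy (t n) (p n)" for n
  define c where "c = (LINT x|M. (1::real))"
  have m_le: "m n \<le> c" for n
    using p(2)[of "(\<lambda>x. 0, \<lambda>x. 0)" n] zero_gradient by (simp add: m_def resolvent_energy_def gradient_graph_def c_def)
  have energy_mono: "resolvent_energy (t i) q \<le> resolvent_energy (t j) q" if "i \<le> j" for i j q
    using that by (auto simp: resolvent_energy_def t_def intro!: mult_right_mono)
  have m_mono: "incseq m"
  proof (rule incseq_SucI)
    fix n
    have "m n \<le> resolvent_energy (t n) (p (Suc n))" unfolding m_def by (rule p)+
    also have "\<dots> \<le> m (Suc n)" unfolding m_def by (rule energy_mono) simp
    finally show "m n \<le> m (Suc n)" .
  qed
  have "convergent m"
    using incseq_convergent[OF m_mono, of c] m_le by (metis convergentI)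
  then have m_Cauchy: "Cauchy m" by (rule convergent_Cauchy)
  \<comment> \<open>The parallelogram law for the weaker of the two energies, whose value at \<open>p j\<close> is at most \<open>m j\<close>.\<close>
  have dist: "(LINT x|M. (v i x - v j x)\<^sup>2) \<le> 2 * m j - 2 * m i" if "i \<le> j" for i j
  proof -
    obtain z where z: "z \<in> gradient_graph"
        "t i * (LINT x|M. (fst (p i) x - fst (p j) x)\<^sup>2) + (LINT x|M. (snd (p i) x - snd (p j) x)\<^sup>2)
          = 2 * resolvent_energy (t i) (p i) + 2 * resolvent_energy (t i) (p j) - 4 * resolvent_energy (t i) z"
      using resolvent_parallelogram[OF p(1) p(1)] by blast
    have "0 \<le> t i * (LINT x|M. (fst (p i) x - fst (p j) x)\<^sup>2)"
      by (simp add: t_def)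
    moreover have "m i \<le> resolvent_energy (t i) z" unfolding m_def by (rule p(2)[OF z(1)])
    moreover have "resolvent_energy (t i) (p j) \<le> m j" unfolding m_def by (rule energy_mono[OF that])
    ultimately show ?thesis
      using z(2) unfolding v_def m_def by argo
  qed
  have v_Cauchy: "\<exists>N. \<forall>i\<ge>N. \<forall>j\<ge>N. (LINT x|M. (v i x - v j x)\<^sup>2) < e" if e: "0 < e" for e
  proof -
    obtain N where N: "\<And>i j. i \<ge> N \<Longrightarrow> j \<ge> N \<Longrightarrow> \<bar>m i - m j\<bar> < e / 2"
      using m_Cauchy e unfolding Cauchy_def dist_real_def by (meson half_gt_zero)
    have "(LINT x|M. (v i x - v j x)\<^sup>2) < e" if "i \<ge> N" "j \<ge> N" for i j
    proof (cases "i \<le> j")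
      case True
      then show ?thesis using dist[OF True] N[OF that] by linarith
    next
      case False
      then have "(LINT x|M. (v j x - v i x)\<^sup>2) < e" using dist[of j i] N[OF that] by linarith
      then show ?thesis by (simp add: power2_commute)
    qed
    then show ?thesis by blast
  qed
  obtain v' where v': "v' \<in> L2 M" "(\<lambda>n. LINT x|M. (v n x - v' x)\<^sup>2) \<longlonglongrightarrow> 0"
    using L2_complete[OF finite_M L2(2) v_Cauchy] by blast
  have u_le: "(LINT x|M. (u n x)\<^sup>2) \<le> c / real (Suc n)" for n
  proof -
    have "t n * (LINT x|M. (u n x)\<^sup>2) \<le> m n"
      unfolding m_def resolvent_energy_def u_def by simp
    with m_le[of n] have "t n * (LINT x|M. (u n x)\<^sup>2) \<le> c" by linarith
    then show ?thesis by (simp add: t_def field_simps)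
  qed
  have u0: "(\<lambda>n. LINT x|M. (u n x - 0)\<^sup>2) \<longlonglongrightarrow> 0"
    using u_le by (intro tendsto_zero_inverse_bound[where c = c]) (simp_all del: of_nat_Suc)
  have v'0: "v' \<in> gradients M (\<lambda>x. 0)"
    by (rule gradients_closed[OF g const_L2 v'(1) u0 v'(2)])
  have euler: "t n * (LINT x|M. u n x * f x) = (LINT x|M. (1 - v n x) * k x)"
    if "k \<in> gradients M f" for n f k
    using resolvent_euler[OF _ _ that, of "u n" "v n" "t n"] p by (simp add: puv[symmetric])
  have wlim: "(\<lambda>n. LINT x|M. ((1 - v n x) - (1 - v' x))\<^sup>2) \<longlonglongrightarrow> 0"
    using v'(2) by (simp add: power2_commute)
  have wL2: "(\<lambda>x. 1 - v n x) \<in> L2 M" for n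
    by (intro L2_diff const_L2 L2)
  show thesis
  proof (rule that[of "\<lambda>n x. 1 - v n x" "\<lambda>n x. t n * u n x" v'])
    show "(LINT x|M. deriv \<phi> x * (1 - v n x)) = (LINT x|M. \<phi> x * (t n * u n x))"
      if "\<phi> \<in> smooth_functions {a..b}" for n \<phi>
    proof -
      have "(LINT x|M. \<phi> x * (t n * u n x)) = (LINT x|M. t n * (u n x * \<phi> x))"
        by (simp only: ac_simps)
      also have "\<dots> = t n * (LINT x|M. u n x * \<phi> x)" by simp
      also have "\<dots> = (LINT x|M. (1 - v n x) * deriv \<phi> x)" by (rule euler[OF smooth_gradient[OF that]])
      finally show ?thesis by (simp only: mult.commute)
    qed
    show "(LINT x|M. (1 - v' x) * k x) = 0" if k: "k \<in> gradients M (\<lambda>x. 0)" for k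
    proof (rule LIMSEQ_unique)
      show "(\<lambda>n. LINT x|M. (1 - v n x) * k x) \<longlonglongrightarrow> (LINT x|M. (1 - v' x) * k x)"
        by (rule L2_inner_tendsto[OF wL2 _ _ wlim]) (intro L2_diff const_L2 v' gradients_L2[OF k])+
      show "(\<lambda>n. LINT x|M. (1 - v n x) * k x) \<longlonglongrightarrow> 0"
        using euler[OF k] by simp
    qed
  qed (use wL2 wlim v'0 L2 in \<open>auto intro: L2_cmult\<close>)
qed

section \<open>Adjoint fields are densities\<close>

text \<open>
  The primitive of \<open>- h M\<close> that vanishes to the right of the interval; it is continuous from the right.
\<close>

definition tail_integral :: "(real \<Rightarrow> real) \<Rightarrow> real \<Rightarrow> real"
  where "tail_integral h x = (LINT y|M. indicator {x<..} y * h y)"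

text \<open>
  \<open>w\<close> is in the domain of the adjoint of the derivative and \<open>h\<close> is its image; distributionally,
  the signed measure \<open>w M\<close> has the derivative \<open>- h M\<close>, also across the end points.
\<close>

definition weak_adjoint :: "(real \<Rightarrow> real) \<Rightarrow> (real \<Rightarrow> real) \<Rightarrow> bool"
  where "weak_adjoint w h \<longleftrightarrow> w \<in> L2 M \<and> h \<in> L2 M \<and>
    (\<forall>\<phi>\<in>smooth_functions {a..b}. (LINT x|M. deriv \<phi> x * w x) = (LINT x|M. \<phi> x * h x))"

lemma sigma_finite_M: "sigma_finite_measure M"
  by unfold_locales

lemma tail_kernel_measurable:
  assumes id: "(\<lambda>x. x) \<in> N \<rightarrow>\<^sub>M borel" and h: "h \<in> borel_measurable M"
  shows "(\<lambda>z. indicat_real {fst z<..} (snd z) * h (snd z)) \<in> borel_measurable (N \<Otimes>\<^sub>M M)"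
proof -
  have 1: "fst \<in> borel_measurable (N \<Otimes>\<^sub>M M)"
    by (rule measurable_compose[OF measurable_fst id])
  have 2: "snd \<in> borel_measurable (N \<Otimes>\<^sub>M M)"
    by (rule measurable_compose[OF measurable_snd measurable_id])
  have 3: "(\<lambda>z. h (snd z)) \<in> borel_measurable (N \<Otimes>\<^sub>M M)"
    by (rule measurable_compose[OF measurable_snd h])
  have "(\<lambda>z. if fst z < snd z then h (snd z) else 0) \<in> borel_measurable (N \<Otimes>\<^sub>M M)"
    by (intro measurable_If 3 borel_measurable_less[OF 1 2]) simp
  moreover have "(\<lambda>z. if fst z < snd z then h (snd z) else 0)
      = (\<lambda>z. indicat_real {fst z<..} (snd z) * h (snd z))"
    by (auto simp: fun_eq_iff indicator_def)
  ultimately show ?thesis by simp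
qed

lemma tail_integral_measurable:
  assumes "h \<in> borel_measurable M"
  shows "tail_integral h \<in> borel_measurable borel"
proof -
  interpret sigma_finite_measure M by (rule sigma_finite_M)
  have "(\<lambda>(x, y). indicat_real {x<..} y * h y) \<in> borel_measurable (borel \<Otimes>\<^sub>M M)"
    using tail_kernel_measurable[OF measurable_ident_sets[OF refl] assms] by (simp add: case_prod_beta')
  from borel_measurable_lebesgue_integral[OF this] show ?thesis
    by (simp add: tail_integral_def[abs_def])
qed

text \<open>
  Take the constant test function. The primitive therefore vanishes at the left end as well.
\<close>

lemma weak_adjoint_integral_zero:
  assumes "weak_adjoint w h" shows "(LINT x|M. h x) = 0"
proof -
  have "(LINT x|M. deriv (poly [:1:]) x * w x) = (LINT x|M. poly [:1:] x * h x)"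
    using assms poly_smooth[of "[:1:]" "{a..b}"] unfolding weak_adjoint_def by blast
  then show ?thesis by (simp only: deriv_poly) simp
qed

text \<open>
  The integration by parts behind \<open>w M = W dx\<close>. For a polynomial \<open>p\<close> with primitive \<open>P\<close>, insert
  \<open>P(y) = P(a) + \<integral>\<^bsub>(a,y)\<^esub> p dx\<close> into \<open>\<integral> p w dM = \<integral> P h dM\<close> and exchange the integrals; the
  constant \<open>P(a)\<close> drops out because \<open>h\<close> has integral zero. So the two sides have the same moments.
\<close>

lemma weak_adjoint_density:
  assumes wh: "weak_adjoint w h" and f: "f \<in> borel_measurable borel" "\<And>x. \<bar>f x\<bar> \<le> B"
  shows "(LINT x|M. f x * w x) = (LINT x|lborel. indicator {a<..<b} x * (f x * tail_integral h x))"
proof -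
  define L where "L = restrict_space lborel {a<..<b}"
  have L_int: "(LINT x|L. g x) = (LINT x|lborel. indicator {a<..<b} x * g x)" for g :: "real \<Rightarrow> real"
    unfolding L_def by (subst integral_restrict_space) auto
  have space_L: "space L = {a<..<b}" by (simp add: L_def space_restrict_space)
  interpret L: finite_measure L
  proof
    have "emeasure L (space L) = emeasure lborel {a<..<b}"
      unfolding space_L unfolding L_def by (subst emeasure_restrict_space) auto
    then show "emeasure L (space L) \<noteq> \<infinity>" using ab by simp
  qed
  interpret pair_sigma_finite L M
    by (intro pair_sigma_finite.intro sigma_finite_M L.sigma_finite_measure_axioms)
  have idL: "(\<lambda>x. x) \<in> L \<rightarrow>\<^sub>M borel"
    unfolding L_def by (intro measurable_restrict_space1) simp
  have w: "w \<in> L2 M" and h: "h \<in> L2 M" using wh by (auto simp: weak_adjoint_def)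
  have hm: "h \<in> borel_measurable M" and hi: "integrable M h"
    using h L2_integrable[OF finite_M] by (auto intro: L2_measurable)
  have kernel_int: "integrable (L \<Otimes>\<^sub>M M) (\<lambda>z. poly p (fst z) * (indicat_real {fst z<..} (snd z) * h (snd z)))"
    for p
  proof -
    have "compact (poly p ` {a..b})"
      by (intro compact_continuous_image continuous_on_poly continuous_on_id) simp
    then obtain C where C: "\<And>x. x \<in> {a..b} \<Longrightarrow> \<bar>poly p x\<bar> \<le> C"
      using compact_imp_bounded[of "poly p ` {a..b}"] unfolding bounded_iff real_norm_def by (meson imageI)
    have hsnd: "(\<lambda>z. h (snd z)) \<in> borel_measurable (L \<Otimes>\<^sub>M M)"
      by (rule measurable_compose[OF measurable_snd hm])
    have "integrable (L \<Otimes>\<^sub>M M) (\<lambda>z. h (snd z))"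
      using hi by (intro Fubini_integrable hsnd) auto
    then have "integrable (L \<Otimes>\<^sub>M M) (\<lambda>z. C * \<bar>h (snd z)\<bar>)"
      by simp
    then show ?thesis
    proof (rule Bochner_Integration.integrable_bound)
      have "poly p \<in> borel_measurable borel"
        by (intro borel_measurable_continuous_onI continuous_on_poly continuous_on_id)
      from measurable_compose[OF measurable_fst measurable_compose[OF idL this]]
      show "(\<lambda>z. poly p (fst z) * (indicat_real {fst z<..} (snd z) * h (snd z))) \<in> borel_measurable (L \<Otimes>\<^sub>M M)"
        by (rule borel_measurable_times) (rule tail_kernel_measurable[OF idL hm])
      show "AE z in L \<Otimes>\<^sub>M M. norm (poly p (fst z) * (indicat_real {fst z<..} (snd z) * h (snd z)))
          \<le> norm (C * \<bar>h (snd z)\<bar>)"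
      proof (rule AE_I2)
        fix z assume "z \<in> space (L \<Otimes>\<^sub>M M)"
        then have "fst z \<in> {a..b}" by (auto simp: space_pair_measure space_L)
        from C[OF this] have "\<bar>poly p (fst z)\<bar> * (indicat_real {fst z<..} (snd z) * \<bar>h (snd z)\<bar>) \<le> \<bar>C\<bar> * (1 * \<bar>h (snd z)\<bar>)"
          by (intro mult_mono) (auto simp: indicator_def)
        then show "norm (poly p (fst z) * (indicat_real {fst z<..} (snd z) * h (snd z))) \<le> norm (C * \<bar>h (snd z)\<bar>)"
          by (simp add: abs_mult)
      qed
    qed
  qed
  have tail_int: "integrable L (tail_integral h)"
    using integrable_fst'[OF kernel_int[of 1]] by (simp add: tail_integral_def[abs_def])
  have moments: "(LINT x|M. poly p x * w x) = (LINT x|L. poly p x * tail_integral h x)" for p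
  proof -
    obtain P where P: "pderiv P = p" using poly_primitive by blast
    have "(LINT x|M. poly p x * w x) = (LINT x|M. deriv (poly P) x * w x)"
      by (simp add: deriv_poly P)
    also have "\<dots> = (LINT y|M. poly P y * h y)"
      using wh poly_smooth unfolding weak_adjoint_def by blast
    also have "\<dots> = (LINT y|M. poly P a * h y + (LINT x|L. poly p x * (indicat_real {x<..} y * h y)))"
    proof (intro Bochner_Integration.integral_cong refl)
      fix y assume "y \<in> space M"
      then have y: "a < y" "y < b" by (auto simp: space_M)
      have "(LINT x|L. poly p x * (indicat_real {x<..} y * h y)) = (LINT x|lborel. h y * (indicat_real {a<..<y} x * poly p x))"
        unfolding L_int using y by (intro Bochner_Integration.integral_cong) (auto simp: indicator_def)
      also have "\<dots> = h y * (poly P y - poly P a)"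
        using y by (subst integral_mult_right_zero, subst integral_lebesgue_interval[where F = "poly P"])
          (auto intro: DERIV_subset[OF poly_DERIV[where p = P], unfolded P] continuous_on_poly continuous_on_id)
      finally show "poly P y * h y = poly P a * h y + (LINT x|L. poly p x * (indicat_real {x<..} y * h y))"
        by (simp add: algebra_simps)
    qed
    also have "\<dots> = poly P a * (LINT y|M. h y) + (LINT y|M. (LINT x|L. poly p x * (indicat_real {x<..} y * h y)))"
      using hi integrable_snd[of "\<lambda>x y. poly p x * (indicat_real {x<..} y * h y)"] kernel_int[of p]
      by (subst Bochner_Integration.integral_add) (auto simp: case_prod_beta')
    also have "\<dots> = (LINT y|M. (LINT x|L. poly p x * (indicat_real {x<..} y * h y)))"
      by (simp add: weak_adjoint_integral_zero[OF wh])
    also have "\<dots> = (LINT x|L. (LINT y|M. poly p x * (indicat_real {x<..} y * h y)))"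
      using kernel_int[of p] by (intro Fubini_integral) (simp add: case_prod_beta')
    also have "\<dots> = (LINT x|L. poly p x * tail_integral h x)"
      by (simp add: tail_integral_def)
    finally show ?thesis .
  qed
  have "(LINT x|M. f x * w x) = (LINT x|L. f x * tail_integral h x)"
    by (rule moments_determine_density[OF measurable_id idL _ _ L2_integrable[OF finite_M w] tail_int moments f, of a b])
      (auto simp: space_M space_L)
  then show ?thesis by (simp add: L_int)
qed

section \<open>Right equicontinuity at regular points\<close>

text \<open>
  Test \<open>w M = W dx\<close> with the sign of \<open>w\<close> on the set \<open>{W = 0}\<close>.
\<close>

lemma weak_adjoint_nonzero_AE:
  assumes wh: "weak_adjoint w h"
  shows "AE x in M. w x \<noteq> 0 \<longrightarrow> tail_integral h x \<noteq> 0"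
proof -
  have w: "w \<in> L2 M" and h: "h \<in> borel_measurable M"
    using wh by (auto simp: weak_adjoint_def intro: L2_measurable)
  have wm: "w \<in> borel_measurable M" and wi: "integrable M w"
    using w L2_integrable[OF finite_M] by (auto intro: L2_measurable)
  have "w \<in> borel_measurable (restrict_space borel {a<..<b})"
    using wm by (subst (asm) measurable_cong_sets[OF sets_M refl])
  then have ext: "(\<lambda>x. indicator {a<..<b} x * w x) \<in> borel_measurable borel"
    by (subst (asm) borel_measurable_restrict_space_iff) (auto simp: mult.commute)
  define f where "f x = indicator {x. tail_integral h x = 0} x * sgn (indicator {a<..<b} x * w x)" for x
  have "{x \<in> space borel. tail_integral h x = 0} \<in> sets borel"
    using tail_integral_measurable[OF h] by (intro borel_measurable_eq) auto
  then have fm: "f \<in> borel_measurable borel"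
    unfolding f_def
    by (intro borel_measurable_times borel_measurable_indicator measurable_compose[OF ext borel_measurable_sgn])
      (auto intro: borel_measurable_sgn)
  have fb: "\<bar>f x\<bar> \<le> 1" for x
    by (auto simp: f_def indicator_def sgn_real_def)
  have fw: "f x * w x = indicator {x. tail_integral h x = 0} x * \<bar>w x\<bar>" if "x \<in> space M" for x
    using that by (auto simp: f_def space_M sgn_real_def)
  have "(LINT x|M. f x * w x) = (LINT x|lborel. indicator {a<..<b} x * (f x * tail_integral h x))"
    by (rule weak_adjoint_density[OF wh fm fb])
  also have "\<dots> = (LINT x::real|lborel. 0)"
    by (intro Bochner_Integration.integral_cong) (auto simp: f_def indicator_def)
  finally have "(LINT x|M. f x * w x) = 0" by simp
  moreover have "integrable M (\<lambda>x. f x * w x)"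
    by (rule bounded_mult_integrable[OF measurable_id fm fb wi])
  moreover have "AE x in M. 0 \<le> f x * w x"
    by (intro AE_I2) (simp add: fw)
  ultimately have "AE x in M. f x * w x = 0"
    by (simp add: integral_nonneg_eq_0_iff_AE)
  then show ?thesis
    using AE_space
  proof eventually_elim
    case (elim x)
    then show ?case using fw[of x] by (auto simp: indicator_def)
  qed
qed

lemma integrable_indicator_mult:
  fixes g :: "real \<Rightarrow> real"
  assumes "A \<in> sets borel" "integrable M g"
  shows "integrable M (\<lambda>y. indicat_real A y * g y)"
  using assms by (intro bounded_mult_integrable[OF measurable_id _ _ assms(2), where B = 1]) auto

text \<open>
  The intervals are open on the left, so an atom at \<open>x\<close> does not count.
\<close>

lemma integral_right_interval_small:
  fixes g :: "real \<Rightarrow> real"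
  assumes g: "integrable M g" and e: "0 < e"
  shows "\<exists>d>0. (LINT y|M. indicator {x<..<x + d} y * \<bar>g y\<bar>) < e"
proof -
  define A where "A n = {x<..<x + 1 / real (Suc n)}" for n
  have "(\<lambda>n. LINT y|M. indicat_real (A n) y * \<bar>g y\<bar>) \<longlonglongrightarrow> (LINT y|M. 0)"
  proof (rule integral_dominated_convergence[where w = "\<lambda>y. \<bar>g y\<bar>"])
    show "(\<lambda>y. indicat_real (A n) y * \<bar>g y\<bar>) \<in> borel_measurable M" for n
      using g by (intro borel_measurable_integrable integrable_indicator_mult integrable_abs) (auto simp: A_def)
    show "AE y in M. (\<lambda>n. indicat_real (A n) y * \<bar>g y\<bar>) \<longlonglongrightarrow> 0"
    proof (rule AE_I2)
      fix y
      have "\<forall>\<^sub>F n in sequentially. y \<notin> A n"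
      proof (cases "x < y")
        case True
        then obtain N where N: "1 / real (Suc N) < y - x" using nat_approx_posE[of "y - x"] by auto
        have "y \<notin> A n" if "n \<ge> N" for n
        proof -
          have "1 / real (Suc n) \<le> 1 / real (Suc N)" using that by (intro divide_left_mono) auto
          then show ?thesis using N unfolding A_def by auto
        qed
        then show ?thesis unfolding eventually_sequentially by blast
      qed (simp add: A_def)
      then have "\<forall>\<^sub>F n in sequentially. indicat_real (A n) y * \<bar>g y\<bar> = 0"
        by eventually_elim simp
      then show "(\<lambda>n. indicat_real (A n) y * \<bar>g y\<bar>) \<longlonglongrightarrow> 0" by (rule tendsto_eventually)
    qed
    show "AE y in M. norm (indicat_real (A n) y * \<bar>g y\<bar>) \<le> \<bar>g y\<bar>" for n
      by (intro AE_I2) (auto simp: indicator_def)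
  qed (use g in auto)
  then have "\<forall>\<^sub>F n in sequentially. (LINT y|M. indicat_real (A n) y * \<bar>g y\<bar>) < e"
    using e by (intro order_tendstoD(2)) auto
  then obtain n where "(LINT y|M. indicat_real (A n) y * \<bar>g y\<bar>) < e"
    using eventually_happens'[OF sequentially_bot] by blast
  then show ?thesis
    unfolding A_def by (intro exI[of _ "1 / real (Suc n)"]) simp
qed

lemma tail_integral_right_lower_bound:
  assumes wh: "weak_adjoint w h" and W: "0 < tail_integral h x"
  shows "\<exists>d>0. \<forall>y\<in>{x<..<x + d}. tail_integral h x / 2 \<le> tail_integral h y"
proof -
  have h: "integrable M h"
    using wh L2_integrable[OF finite_M] by (auto simp: weak_adjoint_def)
  obtain d where d: "0 < d" "(LINT y|M. indicator {x<..<x + d} y * \<bar>h y\<bar>) < tail_integral h x / 2"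
    using integral_right_interval_small[OF h, of "tail_integral h x / 2" x] W by auto
  have "tail_integral h x / 2 \<le> tail_integral h y" if y: "y \<in> {x<..<x + d}" for y
  proof -
    have "tail_integral h x - tail_integral h y = (LINT t|M. indicator {x<..} t * h t - indicator {y<..} t * h t)"
      unfolding tail_integral_def using integrable_indicator_mult[OF _ h] by simp
    also have "\<dots> \<le> (LINT t|M. indicator {x<..<x + d} t * \<bar>h t\<bar>)"
      using y h
      by (intro integral_mono Bochner_Integration.integrable_diff integrable_indicator_mult integrable_abs)
        (auto simp: indicator_def)
    finally show ?thesis using d(2) by linarith
  qed
  then show ?thesis using d(1) by blast
qed

text \<open>
  Where \<open>W \<ge> c\<close>, the Lebesgue measure is dominated by \<open>w M / c\<close>.
\<close>

lemma weak_adjoint_lower_bound: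
  assumes wh: "weak_adjoint w h" and J: "J \<in> sets borel" "J \<subseteq> {a<..<b}"
    and c: "\<And>t. t \<in> J \<Longrightarrow> c \<le> tail_integral h t"
    and f: "f \<in> borel_measurable borel" "\<And>t. 0 \<le> f t" "\<And>t. f t \<le> B"
  shows "c * (LINT t|lborel. indicator J t * f t) \<le> (LINT t|M. indicator J t * f t * w t)"
proof -
  have h: "integrable M h" and hm: "h \<in> borel_measurable M"
    using wh L2_integrable[OF finite_M] by (auto simp: weak_adjoint_def intro: L2_measurable)
  define C where "C = (LINT t|M. \<bar>h t\<bar>)"
  have C: "\<bar>tail_integral h t\<bar> \<le> C" for t
  proof -
    have "\<bar>tail_integral h t\<bar> \<le> (LINT y|M. \<bar>indicator {t<..} y * h y\<bar>)"
      unfolding tail_integral_def by (rule integral_abs_bound)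
    also have "\<dots> \<le> C"
      unfolding C_def using h
      by (intro integral_mono integrable_abs integrable_indicator_mult) (auto simp: indicator_def)
    finally show ?thesis .
  qed
  define g where "g t = indicator J t * f t" for t
  have gm: "g \<in> borel_measurable borel"
    unfolding g_def by (intro borel_measurable_times borel_measurable_indicator J f)
  have B: "0 \<le> B" using f(2,3)[of 0] by linarith
  have gb: "\<bar>g t\<bar> \<le> B" for t
    using f(2,3)[of t] B by (auto simp: g_def indicator_def)
  have bounded: "integrable lborel (\<lambda>t. indicator {a<..<b} t * k t)"
    if "k \<in> borel_measurable borel" "\<And>t. \<bar>k t\<bar> \<le> D" for k :: "real \<Rightarrow> real" and D
  proof (rule Bochner_Integration.integrable_bound)
    show "integrable lborel (\<lambda>t. D * indicat_real {a<..<b} t)"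
      using ab by (intro integrable_mult_right integrable_real_indicator) auto
    show "(\<lambda>t. indicator {a<..<b} t * k t) \<in> borel_measurable lborel"
      using that(1) by (intro borel_measurable_times) auto
    show "AE t in lborel. norm (indicator {a<..<b} t * k t) \<le> norm (D * indicat_real {a<..<b} t)"
      using that(2) by (intro AE_I2) (auto simp: indicator_def intro: order_trans[OF _ abs_ge_self])
  qed
  have "c * (LINT t|lborel. indicator J t * f t) = (LINT t|lborel. indicator {a<..<b} t * (c * g t))"
    using J(2) by (subst integral_mult_right_zero[symmetric])
      (intro Bochner_Integration.integral_cong, auto simp: g_def indicator_def)
  also have "\<dots> \<le> (LINT t|lborel. indicator {a<..<b} t * (g t * tail_integral h t))"
  proof (rule integral_mono)
    show "integrable lborel (\<lambda>t. indicator {a<..<b} t * (c * g t))"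
      using gm gb by (intro bounded[where D = "\<bar>c\<bar> * B"]) (auto simp: abs_mult intro: mult_left_mono)
    show "integrable lborel (\<lambda>t. indicator {a<..<b} t * (g t * tail_integral h t))"
    proof (rule bounded)
      show "(\<lambda>t. g t * tail_integral h t) \<in> borel_measurable borel"
        by (intro borel_measurable_times gm tail_integral_measurable hm)
      show "\<bar>g t * tail_integral h t\<bar> \<le> B * C" for t
        unfolding abs_mult using gb C B by (intro mult_mono) auto
    qed
    show "indicator {a<..<b} t * (c * g t) \<le> indicator {a<..<b} t * (g t * tail_integral h t)" for t
      using c[of t] f(2)[of t] by (auto simp: g_def indicator_def mult.commute[of c] intro: mult_left_mono)
  qed
  also have "\<dots> = (LINT t|M. g t * w t)"
    by (rule weak_adjoint_density[OF wh gm gb, symmetric])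
  finally show ?thesis by (simp add: g_def)
qed

text \<open>
  On an interval to the right of \<open>x\<close> where \<open>W\<close> is bounded below, \<open>w M = W dx\<close> is a nonzero measure.
\<close>

lemma regular_point_positive:
  assumes wh: "weak_adjoint w h" and W: "0 < tail_integral h x" and x: "x \<in> {a<..<b}"
    and d: "0 < d" "x + d \<le> b"
  shows "0 < measure M {x<..<x + d}"
proof (rule ccontr)
  assume "\<not> 0 < measure M {x<..<x + d}"
  then have m0: "measure M {x<..<x + d} = 0" using measure_nonneg[of M] by (simp add: order.antisym not_less)
  obtain d0 where d0: "0 < d0" "\<And>y. y \<in> {x<..<x + d0} \<Longrightarrow> tail_integral h x / 2 \<le> tail_integral h y"
    using tail_integral_right_lower_bound[OF wh W] by blast
  define r where "r = min d d0"
  have r: "0 < r" "r \<le> d" "r \<le> d0" using d d0 by (auto simp: r_def)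
  have sub: "{x<..<x + r} \<subseteq> {a<..<b}" "{x<..<x + d} \<subseteq> {a<..<b}" using r d x by auto
  have "{x<..<x + d} \<in> sets M"
    unfolding sets_M by (subst sets_restrict_space_iff) (use sub in auto)
  then have "{x<..<x + d} \<in> null_sets M"
    using m0 by (intro null_setsI) (simp add: emeasure_eq_measure)
  then have "AE t in M. t \<notin> {x<..<x + d}" by (rule AE_not_in)
  then have "AE t in M. indicator {x<..<x + r} t * 1 * w t = 0"
    by eventually_elim (use r in \<open>auto simp: indicator_def\<close>)
  then have "(LINT t|M. indicator {x<..<x + r} t * 1 * w t) = 0"
    by (rule integral_eq_zero_AE)
  moreover have "tail_integral h x / 2 * (LINT t|lborel. indicator {x<..<x + r} t * 1)
      \<le> (LINT t|M. indicator {x<..<x + r} t * 1 * w t)"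
    using d0(2) r sub by (intro weak_adjoint_lower_bound[OF wh, where B = 1]) auto
  moreover have "(LINT t|lborel. indicat_real {x<..<x + r} t * 1) = r"
    using r by simp
  ultimately show False using W r(1) by (simp add: mult_le_0_iff)
qed

text \<open>
  The increment of \<open>\<phi>\<close> is an integral of its derivative against the Lebesgue measure, which is
  dominated by \<open>w M / c\<close>; Young's inequality then separates the derivative from \<open>w\<close>.
\<close>

lemma smooth_increment_bound:
  assumes \<phi>: "\<phi> \<in> smooth_functions {a..b}" and wh: "weak_adjoint w h"
    and xy: "a < x" "x < y" "y < b" and c: "0 < c" "\<And>t. t \<in> {x<..<y} \<Longrightarrow> c \<le> tail_integral h t"
    and e: "0 < e"
  shows "c * \<bar>\<phi> y - \<phi> x\<bar> \<le> e * (LINT t|M. (deriv \<phi> t)\<^sup>2) + (LINT t|M. indicator {x<..<y} t * (w t)\<^sup>2) / e"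
proof -
  obtain g where g: "continuous_on {a..b} g"
    "\<And>x. x \<in> {a..b} \<Longrightarrow> (\<phi> has_real_derivative g x) (at x within {a..b})"
    "\<And>x. x \<in> {a<..<b} \<Longrightarrow> deriv \<phi> x = g x"
    using smooth_continuous_derivative[OF \<phi>] by metis
  have w: "w \<in> L2 M" using wh by (simp add: weak_adjoint_def)
  define J where "J = {x<..<y}"
  have J: "J \<in> sets borel" "J \<subseteq> {a<..<b}" using xy by (auto simp: J_def)
  define f where "f t = indicator {a..b} t * \<bar>g t\<bar>" for t
  have "(\<lambda>t. indicator {a..b} t *\<^sub>R \<bar>g t\<bar>) \<in> borel_measurable borel"
    by (intro borel_measurable_continuous_on_indicator continuous_intros g) auto
  then have fm: "f \<in> borel_measurable borel" by (simp add: f_def[abs_def])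
  have "compact (g ` {a..b})" by (intro compact_continuous_image g) simp
  then obtain B where B: "\<And>t. t \<in> {a..b} \<Longrightarrow> \<bar>g t\<bar> \<le> B"
    using compact_imp_bounded[of "g ` {a..b}"] unfolding bounded_iff real_norm_def by (meson imageI)
  have "0 \<le> B" using B[of a] ab by auto
  then have fb: "0 \<le> f t" "f t \<le> B" for t using B[of t] by (auto simp: f_def indicator_def)
  have sub: "{x..y} \<subseteq> {a..b}" using xy by auto
  have "\<phi> y - \<phi> x = (LINT t|lborel. indicator J t * g t)"
    unfolding J_def using xy
    by (intro integral_lebesgue_interval[symmetric] continuous_on_subset[OF g(1) sub] DERIV_subset[OF g(2) sub]) auto
  also have "\<bar>\<dots>\<bar> \<le> (LINT t|lborel. \<bar>indicator J t * g t\<bar>)"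
    by (rule integral_abs_bound)
  also have "\<dots> = (LINT t|lborel. indicator J t * f t)"
    using J(2) by (intro Bochner_Integration.integral_cong) (auto simp: f_def indicator_def)
  finally have "c * \<bar>\<phi> y - \<phi> x\<bar> \<le> c * (LINT t|lborel. indicator J t * f t)"
    using c(1) by simp
  also have "\<dots> \<le> (LINT t|M. indicator J t * f t * w t)"
    by (rule weak_adjoint_lower_bound[OF wh J _ fm fb]) (use c(2) in \<open>auto simp: J_def\<close>)
  also have "\<dots> \<le> (LINT t|M. \<bar>indicator J t * f t * w t\<bar>)"
    by (rule order_trans[OF abs_ge_self integral_abs_bound])
  also have "\<dots> = (LINT t|M. \<bar>deriv \<phi> t * (indicator J t * w t)\<bar>)"
    by (intro Bochner_Integration.integral_cong) (auto simp: f_def indicator_def space_M g(3) abs_mult)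
  also have "\<dots> \<le> e * (LINT t|M. (deriv \<phi> t)\<^sup>2) + (LINT t|M. (indicator J t * w t)\<^sup>2) / e"
  proof (rule L2_young[OF smooth_L2(2)[OF \<phi>] _ e])
    have "(\<lambda>t. (indicat_real J t * w t)\<^sup>2) = (\<lambda>t. indicat_real J t * (w t)\<^sup>2)"
      by (auto simp: fun_eq_iff indicator_def)
    then show "(\<lambda>t. indicator J t * w t) \<in> L2 M"
      using w J(1) integrable_indicator_mult[OF J(1) L2_sq_integrable[OF w]]
        integrable_indicator_mult[OF J(1) L2_integrable[OF finite_M w]]
      by (auto simp: L2_def)
  qed
  also have "(\<lambda>t. (indicat_real J t * w t)\<^sup>2) = (\<lambda>t. indicat_real J t * (w t)\<^sup>2)"
    by (auto simp: fun_eq_iff indicator_def)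
  finally show ?thesis by (simp add: J_def)
qed

text \<open>
  The contribution of \<open>w\<close> in the previous estimate is small on short intervals, independently of the
  smooth function.
\<close>

lemma regular_point_equicontinuous_pos:
  assumes wh: "weak_adjoint w h" and W: "0 < tail_integral h x" and x: "x \<in> {a<..<b}" and e: "0 < e"
  shows "\<exists>d>0. x + d \<le> b \<and> (\<forall>\<phi>\<in>smooth_functions {a..b}. (LINT t|M. (deriv \<phi> t)\<^sup>2) \<le> K \<longrightarrow>
    (\<forall>y\<in>{x<..<x + d}. \<bar>\<phi> y - \<phi> x\<bar> \<le> e))"
proof -
  define c where "c = tail_integral h x / 2"
  have c: "0 < c" using W by (simp add: c_def)
  define k where "k = \<bar>K\<bar> + 1"
  have k: "0 < k" "K \<le> k" by (auto simp: k_def)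
  \<comment> \<open>Half of \<open>c e\<close> is left for each term of the increment bound.\<close>
  define s where "s = c * e / (2 * k)"
  have s: "0 < s" using c e k by (simp add: s_def)
  obtain d0 where d0: "0 < d0" "\<And>y. y \<in> {x<..<x + d0} \<Longrightarrow> c \<le> tail_integral h y"
    using tail_integral_right_lower_bound[OF wh W] unfolding c_def by blast
  have w2: "integrable M (\<lambda>t. (w t)\<^sup>2)"
    using wh L2_sq_integrable by (auto simp: weak_adjoint_def)
  have "0 < s * (c * e / 2)" using s c e by simp
  from integral_right_interval_small[OF w2 this] obtain d1 where d1: "0 < d1"
      "(LINT t|M. indicator {x<..<x + d1} t * \<bar>(w t)\<^sup>2\<bar>) < s * (c * e / 2)"
    by blast
  define d where "d = min d0 (min d1 (b - x))"
  have d: "0 < d" "d \<le> d0" "d \<le> d1" "x + d \<le> b" using d0 d1 x by (auto simp: d_def)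
  have "\<bar>\<phi> y - \<phi> x\<bar> \<le> e"
    if \<phi>: "\<phi> \<in> smooth_functions {a..b}" and K: "(LINT t|M. (deriv \<phi> t)\<^sup>2) \<le> K" and y: "y \<in> {x<..<x + d}" for \<phi> y
  proof -
    have "c * \<bar>\<phi> y - \<phi> x\<bar> \<le> s * (LINT t|M. (deriv \<phi> t)\<^sup>2) + (LINT t|M. indicator {x<..<y} t * (w t)\<^sup>2) / s"
      using d y x by (intro smooth_increment_bound[OF \<phi> wh _ _ _ c _ s] d0) auto
    also have "\<dots> \<le> s * k + s * (c * e / 2) / s"
    proof (intro add_mono mult_left_mono divide_right_mono)
      show "(LINT t|M. (deriv \<phi> t)\<^sup>2) \<le> k" using K k by linarith
      have "(LINT t|M. indicator {x<..<y} t * (w t)\<^sup>2) \<le> (LINT t|M. indicator {x<..<x + d1} t * \<bar>(w t)\<^sup>2\<bar>)"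
        using y d w2 by (intro integral_mono integrable_indicator_mult integrable_abs) (auto simp: indicator_def)
      then show "(LINT t|M. indicator {x<..<y} t * (w t)\<^sup>2) \<le> s * (c * e / 2)" using d1(2) by linarith
    qed (use s in auto)
    also have "\<dots> = c * e" using s k by (simp add: s_def field_simps)
    finally show ?thesis using c by simp
  qed
  then show ?thesis using d(1,4) by blast
qed

lemma weak_adjoint_uminus:
  assumes "weak_adjoint w h"
  shows "weak_adjoint (\<lambda>x. - w x) (\<lambda>x. - h x)" "tail_integral (\<lambda>x. - h x) x = - tail_integral h x"
  using assms L2_cmult[of w M "-1"] L2_cmult[of h M "-1"]
  by (auto simp: weak_adjoint_def tail_integral_def)

text \<open>
  If \<open>W(x) < 0\<close>, pass to the adjoint pair \<open>(- w, - h)\<close>.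
\<close>

lemma regular_point_equicontinuous:
  assumes wh: "weak_adjoint w h" and W: "tail_integral h x \<noteq> 0" and x: "x \<in> {a<..<b}"
  shows "0 < e \<Longrightarrow> \<exists>d>0. x + d \<le> b \<and> (\<forall>\<phi>\<in>smooth_functions {a..b}. (LINT t|M. (deriv \<phi> t)\<^sup>2) \<le> K \<longrightarrow>
      (\<forall>y\<in>{x<..<x + d}. \<bar>\<phi> y - \<phi> x\<bar> \<le> e))"
    and "0 < d \<Longrightarrow> x + d \<le> b \<Longrightarrow> 0 < measure M {x<..<x + d}"
proof -
  obtain w' h' where wh': "weak_adjoint w' h'" "0 < tail_integral h' x"
  proof (cases "0 < tail_integral h x")
    case True
    then show thesis using wh that by blast
  next
    case False
    then show thesis using weak_adjoint_uminus[OF wh] W that[of "\<lambda>x. - w x" "\<lambda>x. - h x"] by auto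
  qed
  show "0 < e \<Longrightarrow> \<exists>d>0. x + d \<le> b \<and> (\<forall>\<phi>\<in>smooth_functions {a..b}. (LINT t|M. (deriv \<phi> t)\<^sup>2) \<le> K \<longrightarrow>
      (\<forall>y\<in>{x<..<x + d}. \<bar>\<phi> y - \<phi> x\<bar> \<le> e))"
    by (rule regular_point_equicontinuous_pos[OF wh' x])
  show "0 < d \<Longrightarrow> x + d \<le> b \<Longrightarrow> 0 < measure M {x<..<x + d}"
    by (rule regular_point_positive[OF wh' x])
qed

text \<open>
  By equicontinuity \<open>\<bar>\<phi>\<bar> \<ge> \<bar>\<phi>(x)\<bar> - 1\<close> on an interval of positive measure, so a large value at \<open>x\<close>
  would contradict the bound on the norm of \<open>\<phi>\<close>.
\<close>

lemma regular_point_bounded: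
  assumes wh: "weak_adjoint w h" and W: "tail_integral h x \<noteq> 0" and x: "x \<in> {a<..<b}"
  shows "\<exists>d>0. x + d \<le> b \<and> (\<exists>B. \<forall>\<phi>\<in>smooth_functions {a..b}. (LINT t|M. (deriv \<phi> t)\<^sup>2) \<le> K \<longrightarrow>
    (LINT t|M. (\<phi> t)\<^sup>2) \<le> K \<longrightarrow> (\<forall>y\<in>{x<..<x + d}. \<bar>\<phi> y\<bar> \<le> B))"
proof -
  obtain d where d: "0 < d" "x + d \<le> b" and osc: "\<And>\<phi> y. \<phi> \<in> smooth_functions {a..b} \<Longrightarrow>
      (LINT t|M. (deriv \<phi> t)\<^sup>2) \<le> K \<Longrightarrow> y \<in> {x<..<x + d} \<Longrightarrow> \<bar>\<phi> y - \<phi> x\<bar> \<le> 1"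
    using regular_point_equicontinuous(1)[OF wh W x, of 1 K] by auto
  define J where "J = {x<..<x + d}"
  define m where "m = measure M J"
  have m: "0 < m" unfolding m_def J_def by (rule regular_point_equicontinuous(2)[OF wh W x d])
  have JI: "J \<subseteq> {a<..<b}" using x d by (auto simp: J_def)
  have J: "J \<in> sets M"
    unfolding sets_M by (subst sets_restrict_space_iff) (use JI in \<open>auto simp: J_def\<close>)
  have "\<bar>\<phi> y\<bar> \<le> K / m + 3"
    if \<phi>: "\<phi> \<in> smooth_functions {a..b}" and D: "(LINT t|M. (deriv \<phi> t)\<^sup>2) \<le> K"
      and K: "(LINT t|M. (\<phi> t)\<^sup>2) \<le> K" and y: "y \<in> J" for \<phi> y
  proof -
    define s where "s = \<bar>\<phi> x\<bar> - 1"
    have "s \<le> K / m + 1"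
    proof (cases "0 \<le> s")
      case True
      have "m * s\<^sup>2 = (LINT t|M. indicator J t * s\<^sup>2)"
        using J by (simp add: m_def)
      also have "\<dots> \<le> (LINT t|M. (\<phi> t)\<^sup>2)"
      proof (rule integral_mono)
        show "integrable M (\<lambda>t. indicator J t * s\<^sup>2)"
          using J by (intro integrable_mult_left integrable_real_indicator) (auto simp: emeasure_eq_measure)
        show "integrable M (\<lambda>t. (\<phi> t)\<^sup>2)" by (intro L2_sq_integrable smooth_L2 \<phi>)
        show "indicator J t * s\<^sup>2 \<le> (\<phi> t)\<^sup>2" for t
        proof (cases "t \<in> J")
          case True
          then have "\<bar>\<phi> t - \<phi> x\<bar> \<le> 1" using osc[OF \<phi> D] by (simp add: J_def)
          then have "s \<le> \<bar>\<phi> t\<bar>" by (simp add: s_def)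
          then have "s\<^sup>2 \<le> \<bar>\<phi> t\<bar>\<^sup>2" using \<open>0 \<le> s\<close> by (intro power_mono)
          then show ?thesis using True by simp
        qed simp
      qed
      finally have "m * s\<^sup>2 \<le> K" using K by linarith
      then have "s\<^sup>2 \<le> K / m" using m by (simp add: field_simps)
      moreover have "s \<le> s\<^sup>2 + 1"
      proof -
        have "0 \<le> (s - 1)\<^sup>2 + s\<^sup>2 + 1" by (intro add_nonneg_nonneg) auto
        also have "(s - 1)\<^sup>2 + s\<^sup>2 + 1 = 2 * (s\<^sup>2 + 1 - s)" by (simp add: power2_eq_square algebra_simps)
        finally show ?thesis by simp
      qed
      ultimately show ?thesis by linarith
    next
      case False
      have "0 \<le> K" using K by (rule order_trans[rotated]) simp
      then have "0 \<le> K / m" using m by simp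
      then show ?thesis using False by linarith
    qed
    moreover have "\<bar>\<phi> y - \<phi> x\<bar> \<le> 1" using osc[OF \<phi> D] y by (simp add: J_def)
    ultimately show ?thesis by (simp add: s_def)
  qed
  then show ?thesis using d unfolding J_def by blast
qed

section \<open>Pointwise compactness\<close>

text \<open>
  The line orthogonal to a nonzero real number is trivial.
\<close>

lemma tangent_space_UNIV_D:
  assumes "tangent_space M x = UNIV"
  shows "L2_projection M (gradients M (\<lambda>x. 0)) (\<lambda>x. 1) x = 0"
proof -
  have "1 \<in> tangent_space M x" using assms by simp
  then show ?thesis
    unfolding tangent_space_def orthogonal_comp_def orthogonal_def by (auto intro: span_base)
qed

text \<open>
  The representative chosen by \<open>L2_projection\<close> exists because \<open>v\<close> has the defining property, and it
  agrees with \<open>v\<close> almost everywhere because their difference lies in \<open>\<Gamma>(0)\<close> and is orthogonal to it.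
\<close>

lemma projection_unique:
  assumes v: "v \<in> gradients M (\<lambda>x. 0)"
    and orth: "\<And>g. g \<in> gradients M (\<lambda>x. 0) \<Longrightarrow> (LINT x|M. (1 - v x) * g x) = 0"
  shows "AE x in M. L2_projection M (gradients M (\<lambda>x. 0)) (\<lambda>x. 1) x = v x"
proof -
  define \<xi> where "\<xi> = L2_projection M (gradients M (\<lambda>x. 0)) (\<lambda>x. 1)"
  have "\<xi> \<in> gradients M (\<lambda>x. 0) \<and> (\<forall>g\<in>gradients M (\<lambda>x. 0). L2_inner M (\<lambda>x. 1 - \<xi> x) g = 0)"
    unfolding \<xi>_def L2_projection_def
    by (rule someI[of _ v]) (use v orth in \<open>auto simp: L2_inner_def\<close>)
  then have \<xi>: "\<xi> \<in> gradients M (\<lambda>x. 0)"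
      "\<And>g. g \<in> gradients M (\<lambda>x. 0) \<Longrightarrow> (LINT x|M. (1 - \<xi> x) * g x) = 0"
    by (auto simp: L2_inner_def)
  define g where "g x = \<xi> x - v x" for x
  have g: "g \<in> gradients M (\<lambda>x. 0)"
    using gradients_lincomb[OF \<xi>(1) v, of 1 "-1"] by (simp add: g_def[abs_def])
  note L2 = gradients_L2(2)[OF \<xi>(1)] gradients_L2(2)[OF v] gradients_L2(2)[OF g]
  have "(LINT x|M. (g x)\<^sup>2) = (LINT x|M. (1 - v x) * g x - (1 - \<xi> x) * g x)"
    by (intro Bochner_Integration.integral_cong) (auto simp: g_def power2_eq_square algebra_simps)
  also have "\<dots> = 0"
    using orth[OF g] \<xi>(2)[OF g] L2_mult_integrable[OF L2_diff[OF const_L2[of 1] L2(2)] L2(3)]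
      L2_mult_integrable[OF L2_diff[OF const_L2[of 1] L2(1)] L2(3)]
    by simp
  finally have "AE x in M. (g x)\<^sup>2 = 0"
    using L2_sq_integrable[OF L2(3)] by (subst (asm) integral_nonneg_eq_0_iff_AE) auto
  then show ?thesis
    unfolding \<xi>_def[symmetric] by eventually_elim (simp add: g_def)
qed

text \<open>
  On the set where \<open>\<xi>\<close> and all \<open>w n\<close> vanish, \<open>w n\<close> differs from its limit \<open>1 - \<xi>\<close> by \<open>1\<close>; hence this
  set is null.
\<close>

lemma regular_points_AE:
  obtains w h :: "nat \<Rightarrow> real \<Rightarrow> real" where "\<And>j. weak_adjoint (w j) (h j)"
    "AE x in M. tangent_space M x = UNIV \<longrightarrow> (\<exists>j. tail_integral (h j) x \<noteq> 0)"
proof -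
  obtain w h :: "nat \<Rightarrow> real \<Rightarrow> real" and v where wh: "\<And>n. w n \<in> L2 M" "\<And>n. h n \<in> L2 M"
      "\<And>n \<phi>. \<phi> \<in> smooth_functions {a..b} \<Longrightarrow> (LINT x|M. deriv \<phi> x * w n x) = (LINT x|M. \<phi> x * h n x)"
      "(\<lambda>n. LINT x|M. (w n x - (1 - v x))\<^sup>2) \<longlonglongrightarrow> 0"
    and v: "v \<in> gradients M (\<lambda>x. 0)"
      "\<And>g. g \<in> gradients M (\<lambda>x. 0) \<Longrightarrow> (LINT x|M. (1 - v x) * g x) = 0"
    using projection_approximation by blast
  have adj: "weak_adjoint (w n) (h n)" for n
    using wh by (simp add: weak_adjoint_def)
  have vL2: "v \<in> L2 M" using v(1) by (rule gradients_L2)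
  have projection: "AE x in M. L2_projection M (gradients M (\<lambda>x. 0)) (\<lambda>x. 1) x = v x"
    by (rule projection_unique[OF v(1)]) (rule v(2))
  define A where "A = {x \<in> space M. v x = 0 \<and> (\<forall>n. w n x = 0)}"
  have "A = {x \<in> space M. v x = 0} \<inter> (\<Inter>n. {x \<in> space M. w n x = 0})" by (auto simp: A_def)
  also have "\<dots> \<in> sets M"
    using L2_measurable[OF vL2] L2_measurable[OF wh(1)]
    by (intro sets.Int sets.countable_INT' borel_measurable_eq) auto
  finally have A: "A \<in> sets M" .
  have "measure M A \<le> (LINT x|M. (w n x - (1 - v x))\<^sup>2)" for n
  proof -
    have "measure M A = (LINT x|M. indicator A x)" using A by simp
    also have "\<dots> \<le> (LINT x|M. (w n x - (1 - v x))\<^sup>2)"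
    proof (rule integral_mono)
      show "integrable M (\<lambda>x. indicat_real A x)"
        using A by (intro integrable_real_indicator) (auto simp: emeasure_eq_measure)
      show "integrable M (\<lambda>x. (w n x - (1 - v x))\<^sup>2)"
        by (intro L2_sq_integrable L2_diff wh const_L2 vL2)
      show "indicat_real A x \<le> (w n x - (1 - v x))\<^sup>2" for x
        by (auto simp: A_def indicator_def)
    qed
    finally show ?thesis .
  qed
  then have "measure M A \<le> 0"
    by (intro LIMSEQ_le_const[OF wh(4)]) auto
  then have "A \<in> null_sets M"
    using A by (intro null_setsI) (simp add: emeasure_eq_measure measure_le_0_iff)
  then have "AE x in M. x \<notin> A" by (rule AE_not_in)
  moreover have "AE x in M. \<forall>n. w n x \<noteq> 0 \<longrightarrow> tail_integral (h n) x \<noteq> 0"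
    unfolding AE_all_countable using weak_adjoint_nonzero_AE[OF adj] by blast
  ultimately have "AE x in M. tangent_space M x = UNIV \<longrightarrow> (\<exists>j. tail_integral (h j) x \<noteq> 0)"
    using projection AE_space
  proof eventually_elim
    case (elim x)
    show ?case
    proof
      assume "tangent_space M x = UNIV"
      then have "v x = 0" using tangent_space_UNIV_D elim(3) by metis
      then obtain n where "w n x \<noteq> 0" using elim(1,4) by (auto simp: A_def)
      then show "\<exists>j. tail_integral (h j) x \<noteq> 0" using elim(2) by blast
    qed
  qed
  with adj show thesis by (rule that)
qed

text \<open>
  Approximate \<open>u\<close> together with its tangential gradient.
\<close>

lemma smooth_approximation:
  assumes u: "u \<in> H1 M" and C: "H1_norm M u \<le> C" and e: "0 < e" "e \<le> 1"
  shows "\<exists>\<phi>\<in>smooth_functions {a..b}. (LINT x|M. (\<phi> x - u x)\<^sup>2) < e \<and>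
    (LINT x|M. (\<phi> x)\<^sup>2) \<le> 2 + 2 * C\<^sup>2 \<and> (LINT x|M. (deriv \<phi> x)\<^sup>2) \<le> 2 + 2 * C\<^sup>2"
proof -
  define v where "v = tangential_gradient M u"
  have v: "v \<in> gradients M u"
    unfolding v_def by (rule tangential_gradient_in_gradients[OF u])
  note L2 = gradients_L2[OF v]
  have "(LINT x|M. (u x)\<^sup>2) + (LINT x|M. (v x)\<^sup>2) \<le> C\<^sup>2"
    using C by (intro sqrt_le_D) (simp add: H1_norm_def L2_norm_eq v_def)
  moreover have "0 \<le> (LINT x|M. (u x)\<^sup>2)" "0 \<le> (LINT x|M. (v x)\<^sup>2)" by simp_all
  ultimately have uv: "(LINT x|M. (u x)\<^sup>2) \<le> C\<^sup>2" "(LINT x|M. (v x)\<^sup>2) \<le> C\<^sup>2" by linarith+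
  obtain \<phi> where \<phi>: "\<phi> \<in> smooth_functions {a..b}" "(LINT x|M. (\<phi> x - u x)\<^sup>2) < e"
      "(LINT x|M. (deriv \<phi> x - v x)\<^sup>2) < e"
    using v e(1) unfolding gradients_iff by blast
  have "(LINT x|M. (\<phi> x)\<^sup>2) \<le> 2 * (LINT x|M. (\<phi> x - u x)\<^sup>2) + 2 * (LINT x|M. (u x)\<^sup>2)"
    using L2_sq_triangle3[OF smooth_L2(1)[OF \<phi>(1)] L2(1) const_L2[of 0]] by simp
  moreover have "(LINT x|M. (deriv \<phi> x)\<^sup>2) \<le> 2 * (LINT x|M. (deriv \<phi> x - v x)\<^sup>2) + 2 * (LINT x|M. (v x)\<^sup>2)"
    using L2_sq_triangle3[OF smooth_L2(2)[OF \<phi>(1)] L2(2) const_L2[of 0]] by simp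
  ultimately show ?thesis using \<phi> uv e(2) by (intro bexI[of _ \<phi>] conjI) linarith+
qed

text \<open>
  The diagonal subsequence is chosen before any point or adjoint field: it only has to converge at
  those rational points where the given sequence is bounded.
\<close>

lemma bounded_smooth_subsequence:
  assumes \<phi>: "\<And>n. \<phi> n \<in> smooth_functions {a..b}"
    and K: "\<And>n. (LINT x|M. (\<phi> n x)\<^sup>2) \<le> K" "\<And>n. (LINT x|M. (deriv (\<phi> n) x)\<^sup>2) \<le> K"
  obtains k :: "nat \<Rightarrow> nat" where "strict_mono k"
    "\<And>w h x. weak_adjoint w h \<Longrightarrow> tail_integral h x \<noteq> 0 \<Longrightarrow> x \<in> {a<..<b} \<Longrightarrow> convergent (\<lambda>n. \<phi> (k n) x)"
proof -
  define S where "S = {q \<in> \<rat>. \<exists>B. \<forall>n. \<bar>\<phi> n q\<bar> \<le> B}"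
  have countable: "countable S" unfolding S_def by (rule countable_subset[OF _ countable_rat]) blast
  have bounded: "\<exists>B. \<forall>n. \<bar>\<phi> n q\<bar> \<le> B" if "q \<in> S" for q
    using that by (simp add: S_def)
  obtain k :: "nat \<Rightarrow> nat"
    where k: "strict_mono k" "\<And>q. q \<in> S \<Longrightarrow> convergent (\<lambda>n. \<phi> (k n) q)"
    using convergent_subsequence_on_bounded_points[of S \<phi>, OF countable bounded] by metis
  have "convergent (\<lambda>n. \<phi> (k n) x)"
    if wh: "weak_adjoint w h" and W: "tail_integral h x \<noteq> 0" and x: "x \<in> {a<..<b}" for w h x
  proof -
    have "Cauchy (\<lambda>n. \<phi> (k n) x)"
      unfolding Cauchy_def dist_real_def
    proof (intro allI impI)
      fix e :: real assume e: "0 < e"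
      then have "0 < e / 3" by simp
      from regular_point_equicontinuous(1)[OF wh W x this, of K] obtain d1 where d1: "0 < d1"
        "\<And>n y. y \<in> {x<..<x + d1} \<Longrightarrow> \<bar>\<phi> n y - \<phi> n x\<bar> \<le> e / 3"
        using \<phi> K(2) by blast
      from regular_point_bounded[OF wh W x, of K] obtain d2 B where d2: "0 < d2"
        "\<And>n y. y \<in> {x<..<x + d2} \<Longrightarrow> \<bar>\<phi> n y\<bar> \<le> B"
        using \<phi> K by blast
      obtain q where q: "q \<in> \<rat>" "x < q" "q < x + min d1 d2"
        using Rats_dense_in_real[of x "x + min d1 d2"] d1(1) d2(1) by auto
      have osc: "\<bar>\<phi> n q - \<phi> n x\<bar> \<le> e / 3" for n using d1(2)[of q n] q by simp
      have "\<bar>\<phi> n q\<bar> \<le> B" for n using d2(2)[of q n] q by simp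
      then have "q \<in> S" using q(1) by (auto simp: S_def)
      then have "Cauchy (\<lambda>n. \<phi> (k n) q)" using k(2) by (simp add: Cauchy_convergent_iff)
      then obtain N where N: "\<And>m n. m \<ge> N \<Longrightarrow> n \<ge> N \<Longrightarrow> \<bar>\<phi> (k m) q - \<phi> (k n) q\<bar> < e / 3"
        using \<open>0 < e / 3\<close> unfolding Cauchy_def dist_real_def by blast
      have "\<bar>\<phi> (k m) x - \<phi> (k n) x\<bar> < e" if "m \<ge> N" "n \<ge> N" for m n
        using N[OF that] osc[of "k m"] osc[of "k n"] by linarith
      then show "\<exists>N. \<forall>m\<ge>N. \<forall>n\<ge>N. \<bar>\<phi> (k m) x - \<phi> (k n) x\<bar> < e" by blast
    qed
    then show ?thesis by (simp add: Cauchy_convergent_iff)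
  qed
  with k(1) show thesis by (rule that)
qed

lemma pointwise_compactness:
  assumes u: "\<And>n. u n \<in> H1 M" and C: "\<And>n. H1_norm M (u n) \<le> C"
  shows "\<exists>r w. strict_mono (r :: nat \<Rightarrow> nat) \<and>
    (AE x in M. tangent_space M x = UNIV \<longrightarrow> (\<lambda>k. u (r k) x) \<longlonglongrightarrow> w x)"
proof -
  have "\<forall>n. \<exists>\<phi>. \<phi> \<in> smooth_functions {a..b} \<and> (LINT x|M. (\<phi> x - u n x)\<^sup>2) < 1 / real (Suc n) \<and>
      (LINT x|M. (\<phi> x)\<^sup>2) \<le> 2 + 2 * C\<^sup>2 \<and> (LINT x|M. (deriv \<phi> x)\<^sup>2) \<le> 2 + 2 * C\<^sup>2"
  proof
    fix n
    have "0 < 1 / real (Suc n)" "1 / real (Suc n) \<le> 1" by simp_all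
    from smooth_approximation[OF u C this] show "\<exists>\<phi>. \<phi> \<in> smooth_functions {a..b} \<and>
        (LINT x|M. (\<phi> x - u n x)\<^sup>2) < 1 / real (Suc n) \<and>
        (LINT x|M. (\<phi> x)\<^sup>2) \<le> 2 + 2 * C\<^sup>2 \<and> (LINT x|M. (deriv \<phi> x)\<^sup>2) \<le> 2 + 2 * C\<^sup>2"
      by blast
  qed
  from choice[OF this] obtain \<phi> where \<phi>: "\<And>n. \<phi> n \<in> smooth_functions {a..b}"
      and close: "\<And>n. (LINT x|M. (\<phi> n x - u n x)\<^sup>2) < 1 / real (Suc n)"
      and K: "\<And>n. (LINT x|M. (\<phi> n x)\<^sup>2) \<le> 2 + 2 * C\<^sup>2" "\<And>n. (LINT x|M. (deriv (\<phi> n) x)\<^sup>2) \<le> 2 + 2 * C\<^sup>2"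
    by blast
  have uL2: "u n \<in> L2 M" for n using u[of n] by (simp add: H1_def)
  have dL2: "(\<lambda>x. \<phi> n x - u n x) \<in> L2 M" for n by (intro L2_diff smooth_L2(1) \<phi> uL2)
  have "(\<lambda>n. LINT x|M. (\<bar>\<phi> n x - u n x\<bar> - 0)\<^sup>2) \<longlonglongrightarrow> 0"
    using less_imp_le[OF close] by (intro tendsto_zero_inverse_bound[where c = 1]) simp_all
  moreover have "(\<lambda>x. \<bar>\<phi> n x - u n x\<bar>) \<in> L2 M" for n
    using dL2[of n] borel_measurable_abs unfolding L2_def by auto
  ultimately have "(\<lambda>n. LINT x|M. \<bar>\<phi> n x - u n x\<bar> * 1) \<longlonglongrightarrow> (LINT x|M. 0 * 1)"
    by (intro L2_inner_tendsto const_L2)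
  then have "(\<lambda>n. LINT x|M. norm (\<phi> n x - u n x)) \<longlonglongrightarrow> 0" by simp
  from tendsto_L1_AE_subseq[OF L2_integrable[OF finite_M dL2] this]
  obtain r :: "nat \<Rightarrow> nat" where r: "strict_mono r" "AE x in M. (\<lambda>n. \<phi> (r n) x - u (r n) x) \<longlonglongrightarrow> 0"
    by blast
  obtain k :: "nat \<Rightarrow> nat" where k: "strict_mono k"
    "\<And>w h x. weak_adjoint w h \<Longrightarrow> tail_integral h x \<noteq> 0 \<Longrightarrow> x \<in> {a<..<b} \<Longrightarrow> convergent (\<lambda>n. \<phi> (r (k n)) x)"
    by (rule bounded_smooth_subsequence[of "\<lambda>n. \<phi> (r n)", OF \<phi> K]) (rule that)
  obtain w h :: "nat \<Rightarrow> real \<Rightarrow> real" where wh: "\<And>j. weak_adjoint (w j) (h j)"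
    "AE x in M. tangent_space M x = UNIV \<longrightarrow> (\<exists>j. tail_integral (h j) x \<noteq> 0)"
    using regular_points_AE by blast
  have "AE x in M. tangent_space M x = UNIV \<longrightarrow> (\<lambda>n. u ((r \<circ> k) n) x) \<longlonglongrightarrow> lim (\<lambda>n. \<phi> (r (k n)) x)"
    using wh(2) r(2) AE_space
  proof eventually_elim
    case (elim x)
    show ?case
    proof
      assume "tangent_space M x = UNIV"
      then obtain j where "tail_integral (h j) x \<noteq> 0" using elim(1) by blast
      then have "convergent (\<lambda>n. \<phi> (r (k n)) x)"
        using k(2)[OF wh(1)] elim(3) by (simp add: space_M)
      then have lim: "(\<lambda>n. \<phi> (r (k n)) x) \<longlonglongrightarrow> lim (\<lambda>n. \<phi> (r (k n)) x)"
        by (simp add: convergent_LIMSEQ_iff)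
      have "(\<lambda>n. \<phi> (r (k n)) x - u (r (k n)) x) \<longlonglongrightarrow> 0"
        using LIMSEQ_subseq_LIMSEQ[OF elim(2) k(1)] by (simp add: o_def)
      from tendsto_diff[OF lim this] show "(\<lambda>n. u ((r \<circ> k) n) x) \<longlonglongrightarrow> lim (\<lambda>n. \<phi> (r (k n)) x)"
        by simp
    qed
  qed
  moreover have "strict_mono (r \<circ> k)" by (rule strict_mono_o[OF r(1) k(1)])
  ultimately show ?thesis
    by (intro exI[of _ "r \<circ> k"] exI[of _ "\<lambda>x. lim (\<lambda>n. \<phi> (r (k n)) x)"] conjI)
qed

end

theorem proposition2p2:
  fixes a b :: real and I :: "real set" and M :: "real measure"
    and u :: "nat \<Rightarrow> real \<Rightarrow> real"
  assumes "a < b"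
    and "I = {a<..<b}"
    and "finite_measure M"
    and "sets M = sets (restrict_space borel I)"
    and "\<And>n. u n \<in> H1 M"
    and "\<exists>C. \<forall>n. H1_norm M (u n) \<le> C"
  shows "\<exists>(r :: nat \<Rightarrow> nat) (w :: real \<Rightarrow> real). strict_mono r \<and>
    (AE x in M. tangent_space M x = UNIV \<longrightarrow> (\<lambda>k. u (r k) x) \<longlonglongrightarrow> w x)"
proof -
  interpret finite_measure M by fact
  interpret interval_measure M a b
    by unfold_locales (use assms in auto)
  obtain C where C: "H1_norm M (u n) \<le> C" for n
    using assms(6) by auto
  show ?thesis
    by (rule pointwise_compactness[OF assms(5) C])
qed

end
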